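(* Let $g:\mathbb{R}^d\times\mathbb{R}^d\to\mathbb{R}^d$ satisfy $g(x,y)\in \mathrm{T}_x\mathbb{S}^{d-1}$ for all $x,y\in\mathbb{S}^{d-1}$. Let $B,\mu>0$, $x^*\in\mathbb{S}^{d-1}$ and $0<\bar\theta<\pi/2$. Assume: (a) (Stationarity) $g(x,x)=0$ for all $x\in\mathbb{S}^{d-1}$. (b) (Bounded curvature) For every $x\in\mathbb{S}^{d-1}$ with $\theta(x,x^* )\in(0,\bar\theta]$, writing $\theta=\theta(x,x^* )$, $v=x^*_{\perp x}/\|x^*_{\perp x}\|_2$ and $y(t)=\cos(t\theta)x+\sin(t\theta)v$, $t\in[0,1]$: the map $y\mapsto g(x,y)$ has a locally Lipschitz extension $\tilde g_x:\mathcal U_x\to\mathbb{R}^d$ to an open Euclidean neighborhood $\mathcal U_x$ of the geodesic $\{y(t):t\in[0,1]\}$; and for almost every $t\in[0,1]$, every element $M\in\partial_2^Cg(x,y(t))$ satisfies $$v^\top Mv\le-\mu\qquad\text{and}\qquad\|M\|_2\le B .$$ Let $x\in\mathbb{S}^{d-1}$ be such that $\theta=\theta(x,x^* )>0$ satisfies $\tan(\theta/2)\le\min\{\mu/(2B),\tan(\bar\theta/2)\}$. Then $$g(x,x^* )\cdot x^*\le-\frac{\mu}{4B}\,\|g(x,x^* )\|_2\,\sin\theta,$$ i.e., $g(x,x^* )$ is $\mu/(4B)$-RGA at $(x,x^* )$.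
   Context: $\mathbb{S}^{d-1}$ is the unit sphere of $\mathbb{R}^d$; $\mathrm{T}_x\mathbb{S}^{d-1}=\{y:y\perp x\}$; $\theta(x,y)=\arccos(x\cdot y)$ for unit vectors; $x^*_{\perp x}=(I-xx^\top)x^*$; $\|M\|_2$ is the operator norm. The Clarke Jacobian in the second argument is $\partial_2^Cg(x,y)=\mathrm{Conv}\{\lim_{k\to\infty}J\tilde g_x(y_k): y_k\to y,\ \tilde g_x\text{ differentiable at }y_k\}$, where $J$ denotes the Jacobian matrix. A tangent vector $g(x)\perp x$ is $\mu'$-RGA at $(x,x^* )$ if $g(x)\ne0$ whenever $x\neq x^*$ and $g(x)\cdot x^*\le-\mu'\sin(\theta(x,x^* ))\|g(x)\|_2$. *)

theory Defs
  imports "HOL-Analysis.Analysis"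
begin

definition tangent_space :: "real ^ 'n \<Rightarrow> (real ^ 'n) set" where
  "tangent_space x = {y. x \<bullet> y = 0}"

definition sphere_angle :: "real ^ 'n \<Rightarrow> real ^ 'n \<Rightarrow> real" where
  "sphere_angle x y = arccos (x \<bullet> y)"

text \<open>The matrix is $I - x x^T$.\<close>

definition perp_part :: "real ^ 'n \<Rightarrow> real ^ 'n \<Rightarrow> real ^ 'n" where
  "perp_part x z = (mat 1 - (\<chi> i j. x $ i * x $ j)) *v z"

definition geodesic_dir :: "real ^ 'n \<Rightarrow> real ^ 'n \<Rightarrow> real ^ 'n" where
  "geodesic_dir x z = perp_part x z /\<^sub>R norm (perp_part x z)"

definition geodesic :: "real ^ 'n \<Rightarrow> real ^ 'n \<Rightarrow> real \<Rightarrow> real ^ 'n" where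
  "geodesic x z t =
     cos (t * sphere_angle x z) *\<^sub>R x + sin (t * sphere_angle x z) *\<^sub>R geodesic_dir x z"

definition locally_lipschitz_on ::
    "'a::metric_space set \<Rightarrow> ('a \<Rightarrow> 'b::metric_space) \<Rightarrow> bool" where
  "locally_lipschitz_on U f \<longleftrightarrow>
     (\<forall>y\<in>U. \<exists>e>0. \<exists>L. L-lipschitz_on (cball y e \<inter> U) f)"

text \<open>The function \<open>f\<close> is meaningful only on the open set \<open>U\<close>, so the approximating sequences are
  required to stay in \<open>U\<close>.\<close>

definition clarke_jacobian ::
    "(real ^ 'n) set \<Rightarrow> (real ^ 'n \<Rightarrow> real ^ 'm) \<Rightarrow> real ^ 'n \<Rightarrow> (real ^ 'n ^ 'm) set" where
  "clarke_jacobian U f y =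
     convex hull {M. \<exists>Y. Y \<longlonglongrightarrow> y \<and>
       (\<forall>k::nat. Y k \<in> U \<and> f differentiable (at (Y k))) \<and>
       (\<lambda>k. jacobian f (at (Y k))) \<longlonglongrightarrow> M}"

definition rga :: "real \<Rightarrow> real ^ 'n \<Rightarrow> real ^ 'n \<Rightarrow> real ^ 'n \<Rightarrow> bool" where
  "rga \<mu> x xs u \<longleftrightarrow>
     u \<in> tangent_space x \<and> (x \<noteq> xs \<longrightarrow> u \<noteq> 0) \<and>
     u \<bullet> xs \<le> - \<mu> * sin (sphere_angle x xs) * norm u"

text \<open>An extension of \<open>y \<mapsto> g x y\<close> is an extension off the unit sphere: it has to agree with \<open>g x\<close> at
  the points of \<open>U\<close> on the sphere only. The same extension is used in both curvature bounds.\<close>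

definition bounded_curvature_at ::
    "(real ^ 'n \<Rightarrow> real ^ 'n \<Rightarrow> real ^ 'n) \<Rightarrow> real \<Rightarrow> real \<Rightarrow> real ^ 'n \<Rightarrow> real ^ 'n \<Rightarrow> bool" where
  "bounded_curvature_at g B \<mu> xs x \<longleftrightarrow>
     (\<exists>U gt. open U \<and> geodesic x xs ` {0..1} \<subseteq> U \<and>
        (\<forall>y \<in> U \<inter> sphere 0 1. gt y = g x y) \<and>
        locally_lipschitz_on U gt \<and>
        (AE t in lebesgue_on {0..1}. \<forall>M \<in> clarke_jacobian U gt (geodesic x xs t).
           geodesic_dir x xs \<bullet> (M *v geodesic_dir x xs) \<le> - \<mu> \<and> onorm ((*v) M) \<le> B))"

end

theory Submission
  imports Defs
begin

text \<open>Along the geodesic \<open>y\<close> from \<open>x\<close> to \<open>xs\<close> the extension \<open>gt\<close> starts at \<open>g x x = 0\<close> and ends at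
  \<open>G = g x xs\<close>. With \<open>\<theta>\<close> the angle and \<open>v\<close> the initial direction, \<open>y' = \<theta> (cos (t \<theta>) v - sin (t \<theta>) x)\<close>, so the
  curvature bounds give \<open>v \<bullet> M y' \<le> \<theta> (B sin (t \<theta>) - \<mu> cos (t \<theta>))\<close> and \<open>norm (M y') \<le> B \<theta>\<close> for all
  elements \<open>M\<close> of the Clarke Jacobian at almost every point of the geodesic. Integration yields
  \<open>v \<bullet> G \<le> B (1 - cos \<theta>) - \<mu> sin \<theta> = sin \<theta> (B tan (\<theta> / 2) - \<mu>) \<le> - (\<mu> / 2) sin \<theta>\<close> and
  \<open>norm G \<le> B \<theta> \<le> 2 B sin \<theta>\<close>. Since \<open>G\<close> is orthogonal to \<open>x\<close> and \<open>xs = cos \<theta> x + sin \<theta> v\<close>, it follows that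
  \<open>G \<bullet> xs = sin \<theta> (v \<bullet> G) \<le> - (\<mu> / 2) (sin \<theta>)\<^sup>2 \<le> - (\<mu> / (4 B)) norm G sin \<theta>\<close>.

  The integration step (\<open>clarke_jacobian_path_increment\<close>) is Clarke's chain rule. The Clarke Jacobian only
  sees points of differentiability, which may avoid the geodesic altogether, so the step rests on
  Rademacher's theorem: \<open>gt\<close> is differentiable at almost every point, hence by Fubini at almost all points
  of almost every segment parallel to a given one; the derivative bound is integrated there and carried over
  to the tangent segment by continuity (\<open>Lipschitz_directional_mean_value\<close>). Upper semicontinuity of the
  Clarke Jacobian makes its bounds at one point valid, up to \<open>\<epsilon>\<close>, at all nearby points of
  differentiability. Pointwise bounds on upper derivatives are integrated along the path by
  \<open>nonincreasing_if_upper_derivative_nonpos_ae\<close>.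

  Rademacher's theorem is proved without measurable derivatives or integration by parts: in the direction
  of each basis vector the function is almost everywhere differentiable by the one-dimensional case, and
  around almost every point of a closed set on which difference quotients are uniformly controlled, a point
  at distance \<open>r\<close> lies within \<open>o(r)\<close> of that set (\<open>negligible_porous_points\<close>), so that the
  partial increments can be added up along coordinate paths.\<close>

section \<open>Null sets and lines\<close>

text \<open>A Fubini argument for lines in an arbitrary fixed direction \<open>w\<close>. The set
  \<open>{(t, x). x + t w \<in> N}\<close> is measured in both orders: for fixed \<open>t\<close> the slice is a translate of \<open>N\<close>,
  for fixed \<open>x\<close> it is the trace of \<open>N\<close> on a line. No coordinates adapted to \<open>w\<close> are needed.\<close>

lemma emeasure_lborel_line_slices:
  fixes N :: "'a::euclidean_space set" and w :: 'a
  assumes N: "N \<in> sets borel"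
  shows "emeasure lborel N = 0 \<longleftrightarrow> (AE x in lborel. emeasure lborel {t::real. x + t *\<^sub>R w \<in> N} = 0)"
proof -
  define X where "X = {p :: real \<times> 'a. snd p + fst p *\<^sub>R w \<in> N}"
  have X: "X \<in> sets (lborel \<Otimes>\<^sub>M lborel)"
  proof -
    have "(\<lambda>p :: real \<times> 'a. snd p + fst p *\<^sub>R w) -` N \<inter> space borel \<in> sets borel"
      by (intro measurable_sets[OF _ N] borel_measurable_continuous_onI continuous_intros)
    then have "X \<in> sets lborel" by (simp add: X_def vimage_def)
    then show ?thesis by (simp only: lborel_prod)
  qed
  have trans: "emeasure lborel (Pair t -` X) = emeasure lborel N" for t
  proof -
    have "emeasure lborel N = emeasure (distr lborel borel ((+) (t *\<^sub>R w))) N"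
      by (simp add: lborel_distr_plus)
    also have "\<dots> = emeasure lborel ((+) (t *\<^sub>R w) -` N \<inter> space lborel)"
      by (rule emeasure_distr) (use N in auto)
    also have "(+) (t *\<^sub>R w) -` N \<inter> space lborel = Pair t -` X"
      by (auto simp: X_def add.commute)
    finally show ?thesis by simp
  qed
  have meas: "(\<lambda>x. emeasure lborel ((\<lambda>t. (t, x)) -` X)) \<in> borel_measurable (lborel :: 'a measure)"
    using lborel_pair.measurable_emeasure_Pair2[OF X] .
  \<comment> \<open>In \<open>ennreal\<close>, \<open>0 * \<infinity> = 0\<close>, so the product vanishes exactly when \<open>N\<close> is null.\<close>
  have "emeasure lborel N * \<infinity> = emeasure (lborel \<Otimes>\<^sub>M lborel) X"
    by (simp add: lborel.emeasure_pair_measure_alt[OF X] trans)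
  also have "\<dots> = (\<integral>\<^sup>+x. emeasure lborel ((\<lambda>t. (t, x)) -` X) \<partial>lborel)"
    by (rule lborel_pair.emeasure_pair_measure_alt2[OF X])
  finally have eq: "emeasure lborel N * \<infinity> = \<dots>" .
  have "emeasure lborel N = 0 \<longleftrightarrow> (\<integral>\<^sup>+x. emeasure lborel ((\<lambda>t. (t, x)) -` X) \<partial>lborel) = 0"
    by (simp flip: eq)
  also have "\<dots> \<longleftrightarrow> (AE x in lborel. emeasure lborel ((\<lambda>t. (t, x)) -` X) = 0)"
    by (rule nn_integral_0_iff_AE[OF meas])
  also have "\<dots> \<longleftrightarrow> (AE x in lborel. emeasure lborel {t::real. x + t *\<^sub>R w \<in> N} = 0)"
    by (simp add: X_def vimage_def)
  finally show ?thesis .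
qed

section \<open>Lipschitz functions of one real variable\<close>

text \<open>The bounds make \<open>f\<close> a bi-Lipschitz bijection of the line. Lebesgue measure pushed forward along
  the inverse of \<open>f\<close> gives \<open>[a, b]\<close> the mass \<open>f b - f a\<close> and is absolutely continuous, because Lipschitz
  maps preserve null sets. Hence \<open>f\<close> is the indefinite integral of a Radon-Nikodym density, and the
  one-sided Lebesgue differentiation theorem, applied to the density and to its reflection, yields the
  right and the left derivative.\<close>

lemma expanding_Lipschitz_differentiable_ae:
  fixes f :: "real \<Rightarrow> real"
  assumes lower: "\<And>x y. x \<le> y \<Longrightarrow> y - x \<le> f y - f x"
    and upper: "\<And>x y. x \<le> y \<Longrightarrow> f y - f x \<le> K * (y - x)"
  shows "negligible {x. \<not> f differentiable (at x)}"
proof -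
  have mono: "f x \<le> f y \<longleftrightarrow> x \<le> y" for x y
    using lower[of x y] lower[of y x] by linarith
  have lips: "\<bar>f x - f y\<bar> \<le> K * \<bar>x - y\<bar>" for x y
  proof (cases x y rule: le_cases)
    case le then show ?thesis using upper[OF le] mono[of x y] by (simp add: abs_if)
  next
    case ge then show ?thesis using upper[OF ge] mono[of y x] by (simp add: abs_if)
  qed
  have K: "0 \<le> K" using lower[of 0 1] upper[of 0 1] by simp
  have contf: "continuous_on S f" for S
  proof -
    have "K-lipschitz_on S f"
      by (rule lipschitz_onI) (use lips K in \<open>auto simp: dist_real_def\<close>)
    then show ?thesis by (rule lipschitz_on_continuous_on)
  qed
  have inj: "inj f" by (rule injI) (metis mono order_antisym order_refl)
  have surj: "surj f"
  proof -
    have "\<exists>x. f x = y" for y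
    proof -
      define a where "a = \<bar>y - f 0\<bar>"
      have "a \<ge> 0" by (simp add: a_def)
      then have "f (-a) \<le> y" "y \<le> f a"
        using lower[of "-a" 0] lower[of 0 a] unfolding a_def by linarith+
      then show ?thesis using IVT'[of f "-a" y a] contf \<open>a \<ge> 0\<close> by auto
    qed
    then show ?thesis by (metis surjI)
  qed
  define g where "g = inv f"
  have fg: "f (g y) = y" and gf: "g (f x) = x" for x y
    using inj surj by (auto simp: g_def surj_f_inv_f)
  have contg: "continuous_on UNIV g"
  proof -
    have "1-lipschitz_on UNIV g"
    proof (rule lipschitz_onI)
      show "dist (g u) (g v) \<le> 1 * dist u v" for u v
        using lower[of "g u" "g v"] lower[of "g v" "g u"] fg by (auto simp: dist_real_def abs_if)
    qed simp
    then show ?thesis by (rule lipschitz_on_continuous_on)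
  qed
  then have gm[measurable]: "g \<in> borel_measurable borel"
    by (rule borel_measurable_continuous_onI)
  define \<nu> where "\<nu> = distr lborel borel g"
  have em: "emeasure \<nu> A = emeasure lborel (f ` A)" if "A \<in> sets borel" for A
  proof -
    have "g -` A = f ` A" by (auto simp: gf) (metis fg imageI)
    then show ?thesis using that by (simp add: \<nu>_def emeasure_distr)
  qed
  have fA: "f ` A \<in> sets borel" if "A \<in> sets borel" for A
  proof -
    have "g -` A = f ` A" by (auto simp: gf) (metis fg imageI)
    then show ?thesis using measurable_sets[OF gm that] by simp
  qed
  have ac: "absolutely_continuous lborel \<nu>"
    unfolding absolutely_continuous_def
  proof
    fix A :: "real set" assume A: "A \<in> null_sets lborel"
    then have "A \<in> null_sets lebesgue" by (simp add: null_sets_completionI)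
    then have "negligible A" by (simp add: negligible_iff_null_sets)
    then have "negligible (f ` A)"
    proof (rule negligible_locally_Lipschitz_image[rotated])
      fix x
      show "\<exists>T B. open T \<and> x \<in> T \<and> (\<forall>y\<in>A \<inter> T. norm (f y - f x) \<le> B * norm (y - x))"
        by (rule exI[of _ UNIV]) (use lips in auto)
    qed simp
    moreover have Ab: "A \<in> sets borel" using A by auto
    ultimately have "emeasure lborel (f ` A) = 0"
      using fA[OF Ab] by (simp add: negligible_iff_null_sets null_sets_completion_iff null_sets_def)
    then show "A \<in> null_sets \<nu>" using Ab em[OF Ab] by (auto simp: null_sets_def \<nu>_def)
  qed
  obtain \<phi> where \<phi>[measurable]: "\<phi> \<in> borel_measurable lborel" and dens: "density lborel \<phi> = \<nu>"
    using sigma_finite_measure.Radon_Nikodym[OF sigma_finite_lborel ac] by (auto simp: \<nu>_def)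
  have int: "(\<integral>\<^sup>+x. \<phi> x * indicator {a..b} x \<partial>lborel) = ennreal (f b - f a)" if "a \<le> b" for a b
  proof -
    have "f ` {a..b} = {f a..f b}"
    proof
      show "f ` {a..b} \<subseteq> {f a..f b}" using mono by auto
      show "{f a..f b} \<subseteq> f ` {a..b}"
      proof
        fix y assume "y \<in> {f a..f b}"
        then show "y \<in> f ` {a..b}"
          using fg[of y] mono[of a "g y"] mono[of "g y" b] by (intro image_eqI[of _ _ "g y"]) auto
      qed
    qed
    then have "emeasure \<nu> {a..b} = ennreal (f b - f a)"
      using that mono by (simp add: em)
    then show ?thesis by (simp flip: dens add: emeasure_density)
  qed
  have fin: "AE x in lborel. \<phi> x \<noteq> \<infinity>"
  proof -
    have "AE x in lborel. \<forall>n::nat. \<phi> x * indicator {- real n..real n} x \<noteq> \<infinity>"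
      unfolding AE_all_countable
      by (intro allI nn_integral_PInf_AE) (auto simp: int)
    then show ?thesis
    proof (rule AE_mp, intro AE_I2 impI)
      fix x assume *: "\<forall>n::nat. \<phi> x * indicator {- real n..real n} x \<noteq> \<infinity>"
      obtain n :: nat where "\<bar>x\<bar> \<le> n" using real_arch_simple by blast
      then show "\<phi> x \<noteq> \<infinity>" using *[rule_format, of n] by (auto simp: indicator_def abs_le_iff)
    qed
  qed
  define \<psi> where "\<psi> x = enn2real (\<phi> x)" for x
  have hi: "(\<psi> has_integral (f b - f a)) {a..b}" if "a \<le> b" for a b
  proof -
    have "((\<lambda>x. \<psi> x * indicator {a..b} x) has_integral (f b - f a)) UNIV"
    proof (rule nn_integral_has_integral)
      have "(\<integral>\<^sup>+x. ennreal (\<psi> x * indicator {a..b} x) \<partial>lborel)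
          = (\<integral>\<^sup>+x. \<phi> x * indicator {a..b} x \<partial>lborel)"
      proof (rule nn_integral_cong_AE, use fin in \<open>rule AE_mp\<close>, intro AE_I2 impI)
        fix x assume "\<phi> x \<noteq> \<infinity>"
        then show "ennreal (\<psi> x * indicator {a..b} x) = \<phi> x * indicator {a..b} x"
          by (auto simp: \<psi>_def indicator_def less_top)
      qed
      then show "(\<integral>\<^sup>+x. ennreal (\<psi> x * indicator {a..b} x) \<partial>lborel) = ennreal (f b - f a)"
        by (simp add: int[OF that])
    qed (use that mono in \<open>auto simp: \<psi>_def\<close>)
    moreover have "(\<lambda>x. \<psi> x * indicator {a..b} x) = (\<lambda>x. if x \<in> {a..b} then \<psi> x else 0)"
      by (auto simp: indicator_def)
    ultimately show ?thesis using has_integral_restrict_UNIV[of "{a..b}" \<psi> "f b - f a"] by (simp only:)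
  qed
  have "\<psi> integrable_on cbox a b" for a b
    using hi[of a b] by (cases "a \<le> b") auto
  then obtain N1 where N1: "negligible N1" and D1: "\<And>x e. \<lbrakk>x \<notin> N1; 0 < e\<rbrakk> \<Longrightarrow>
      \<exists>d>0. \<forall>h. 0 < h \<and> h < d \<longrightarrow> norm(integral (cbox x (x + h *\<^sub>R One)) \<psi> /\<^sub>R h ^ DIM(real) - \<psi> x) < e"
    using integrable_ccontinuous_explicit[of \<psi>] by blast
  have hi': "((\<lambda>x. \<psi> (- x)) has_integral (f (-a) - f (-b))) {a..b}" if "a \<le> b" for a b
    using has_integral_reflect_lemma_real[OF hi[of "-b" "-a"]] that by simp
  have "(\<lambda>x. \<psi> (- x)) integrable_on cbox a b" for a b
    using hi'[of a b] by (cases "a \<le> b") auto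
  then obtain N2 where N2: "negligible N2" and D2: "\<And>x e. \<lbrakk>x \<notin> N2; 0 < e\<rbrakk> \<Longrightarrow>
      \<exists>d>0. \<forall>h. 0 < h \<and> h < d \<longrightarrow> norm(integral (cbox x (x + h *\<^sub>R One)) (\<lambda>x. \<psi> (- x)) /\<^sub>R h ^ DIM(real) - \<psi> (- x)) < e"
    using integrable_ccontinuous_explicit[of "\<lambda>x. \<psi> (- x)"] by blast
  have diff: "f differentiable (at x)" if x: "x \<notin> N1" "- x \<notin> N2" for x
  proof -
    have "((\<lambda>y. (f y - f x) / (y - x)) \<longlongrightarrow> \<psi> x) (at x)"
      unfolding tendsto_iff eventually_at
    proof (intro allI impI)
      fix e :: real assume e: "e > 0"
      obtain d1 where d1: "d1 > 0" "\<And>h. 0 < h \<Longrightarrow> h < d1 \<Longrightarrow> \<bar>(f (x + h) - f x) / h - \<psi> x\<bar> < e"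
        using D1[OF x(1) e] integral_unique[OF hi, of x "x + _"]
        by (auto simp: divide_inverse mult.commute)
      obtain d2 where d2: "d2 > 0" "\<And>h. 0 < h \<Longrightarrow> h < d2 \<Longrightarrow> \<bar>(f x - f (x - h)) / h - \<psi> x\<bar> < e"
        using D2[OF x(2) e] integral_unique[OF hi', of "-x" "-x + _"]
        by (auto simp: divide_inverse mult.commute)
      show "\<exists>d>0. \<forall>y\<in>UNIV. y \<noteq> x \<and> dist y x < d \<longrightarrow> dist ((f y - f x) / (y - x)) (\<psi> x) < e"
      proof (intro exI[of _ "min d1 d2"] conjI ballI impI)
        fix y assume y: "y \<noteq> x \<and> dist y x < min d1 d2"
        show "dist ((f y - f x) / (y - x)) (\<psi> x) < e"
        proof (cases "x < y")
          case True then show ?thesis using d1(2)[of "y - x"] y by (auto simp: dist_real_def)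
        next
          case False
          then have "(f y - f x) / (y - x) = (f x - f (x - (x - y))) / (x - y)"
            using y by (simp add: field_simps)
          then show ?thesis using d2(2)[of "x - y"] y False by (auto simp: dist_real_def)
        qed
      qed (use d1 d2 in auto)
    qed
    then have "(f has_field_derivative \<psi> x) (at x)" by (simp add: has_field_derivative_iff)
    then show ?thesis by (auto simp: real_differentiable_def)
  qed
  have "negligible (uminus ` N2)"
    by (rule negligible_differentiable_image_negligible[OF _ N2])
      (auto simp: differentiable_on_def intro!: derivative_intros)
  then have "negligible (N1 \<union> uminus ` N2)"
    using N1 by simp
  then show ?thesis
    by (rule negligible_subset) (use diff in \<open>force simp: image_iff\<close>)
qed

lemma Lipschitz_real_differentiable_ae:
  fixes f :: "real \<Rightarrow> 'b::euclidean_space"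
  assumes f: "L-lipschitz_on UNIV f"
  shows "negligible {x. \<not> f differentiable (at x)}"
proof -
  have L: "L \<ge> 0" using f by (rule lipschitz_on_nonneg)
  have neg: "negligible {x. \<not> (\<lambda>x. f x \<bullet> i) differentiable (at x)}" if i: "i \<in> Basis" for i
  proof -
    \<comment> \<open>The linear term makes every slope at least 1 without affecting differentiability.\<close>
    define F where "F x = f x \<bullet> i + (L + 1) * x" for x
    have b: "\<bar>f y \<bullet> i - f x \<bullet> i\<bar> \<le> L * \<bar>y - x\<bar>" for x y
    proof -
      have "\<bar>f y \<bullet> i - f x \<bullet> i\<bar> \<le> norm (f y - f x)"
        using Basis_le_norm[OF i, of "f y - f x"] by (simp add: inner_diff_left)
      also have "\<dots> \<le> L * \<bar>y - x\<bar>"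
        using lipschitz_onD[OF f, of y x] by (simp add: dist_norm)
      finally show ?thesis .
    qed
    have "negligible {x. \<not> F differentiable (at x)}"
    proof (rule expanding_Lipschitz_differentiable_ae[where K = "2 * L + 1"])
      fix x y :: real assume "x \<le> y"
      then show "y - x \<le> F y - F x" "F y - F x \<le> (2 * L + 1) * (y - x)"
        using b[of y x] by (auto simp: F_def algebra_simps abs_le_iff)
    qed
    moreover have "(\<lambda>x. f x \<bullet> i) differentiable (at x)" if "F differentiable (at x)" for x
    proof -
      have "(\<lambda>x. F x - (L + 1) * x) differentiable (at x)"
        using that by (intro derivative_intros) auto
      then show ?thesis by (simp add: F_def)
    qed
    ultimately show ?thesis by (elim negligible_subset) auto
  qed
  have "negligible (\<Union>i\<in>Basis. {x. \<not> (\<lambda>x. f x \<bullet> i) differentiable (at x)})"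
    by (rule negligible_Union) (use neg in auto)
  then show ?thesis
    by (rule negligible_subset) (auto simp: differentiable_componentwise_within[of f])
qed

section \<open>Porous sets are null\<close>

text \<open>The infimum \<open>m\<close> of the measures of the supersets of \<open>S\<close>, its outer measure, satisfies
  \<open>m \<le> c * m\<close>. The set \<open>S\<close> is not assumed to be measurable.\<close>

lemma negligible_if_outer_measure_contracts:
  fixes S :: "'a::euclidean_space set"
  assumes bdd: "bounded S" and c: "0 \<le> c" "c < 1"
    and contr: "\<And>T. \<lbrakk>open T; T \<in> lmeasurable; S \<subseteq> T\<rbrakk> \<Longrightarrow>
      \<exists>T'\<in>lmeasurable. S \<subseteq> T' \<and> measure lebesgue T' \<le> c * measure lebesgue T"
  shows "negligible S"
proof -
  define A where "A = measure lebesgue ` {T. T \<in> lmeasurable \<and> S \<subseteq> T}"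
  obtain r where r: "S \<subseteq> ball 0 r" using bdd bounded_subset_ballD by blast
  have ne: "A \<noteq> {}" using r lmeasurable_ball by (auto simp: A_def simp del: lmeasurable_ball)
  have bb: "bdd_below A" by (rule bdd_belowI[of _ 0]) (auto simp: A_def)
  define m where "m = Inf A"
  have m0: "0 \<le> m" unfolding m_def by (rule cInf_greatest[OF ne]) (auto simp: A_def)
  have "m \<le> c * m"
  proof (rule field_le_epsilon)
    fix e :: real assume e: "e > 0"
    obtain T where T: "T \<in> lmeasurable" "S \<subseteq> T" "measure lebesgue T < m + e / 2"
      using cInf_lessD[OF ne, of "m + e / 2"] e by (auto simp: m_def A_def)
    have "e / 2 > 0" using e by simp
    then obtain U where U: "open U" "T \<subseteq> U" "U - T \<in> lmeasurable"
        "emeasure lebesgue (U - T) < ennreal (e / 2)"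
      using sets_lebesgue_outer_open[OF fmeasurableD[OF T(1)]] by blast
    have Um: "U \<in> lmeasurable"
      using fmeasurable.Un[OF T(1) U(3)] U(2) by (simp add: Un_absorb1)
    have "measure lebesgue (U - T) \<le> e / 2"
      using U(3,4) e by (simp add: emeasure_eq_measure2 ennreal_less_iff)
    then have mU: "measure lebesgue U \<le> m + e"
      using T U Um by (simp add: measurable_measure_Diff)
    obtain T' where T': "T' \<in> lmeasurable" "S \<subseteq> T'" "measure lebesgue T' \<le> c * measure lebesgue U"
      using contr[OF U(1) Um] T(2) U(2) by blast
    have "m \<le> measure lebesgue T'"
      unfolding m_def by (rule cInf_lower[OF _ bb]) (use T' in \<open>auto simp: A_def\<close>)
    also have "\<dots> \<le> c * (m + e)" using T'(3) mult_left_mono[OF mU c(1)] by linarith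
    also have "\<dots> \<le> c * m + e" using e c by (simp add: algebra_simps)
    finally show "m \<le> c * m + e" .
  qed
  then have "(1 - c) * m \<le> 0" by (simp add: algebra_simps)
  then have "m = 0" using c m0 by (simp add: mult_le_0_iff)
  show ?thesis
    unfolding negligible_outer
  proof (intro allI impI)
    fix e :: real assume "e > 0"
    then show "\<exists>T. S \<subseteq> T \<and> T \<in> lmeasurable \<and> measure lebesgue T < e"
      using cInf_lessD[OF ne, of e] \<open>m = 0\<close> by (auto simp: m_def A_def)
  qed
qed

text \<open>A set whose relative measure in arbitrarily small balls around each of its points is at most a
  fixed \<open>c < 1\<close> is null: Vitali's theorem covers almost all of it by disjoint such balls inside any given
  open superset, so its outer measure contracts by the factor \<open>c\<close>.\<close>

lemma negligible_if_density_bounded: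
  fixes S :: "'a::euclidean_space set"
  assumes c: "0 \<le> c" "c < 1"
    and dens: "\<And>x e. \<lbrakk>x \<in> S; 0 < e\<rbrakk> \<Longrightarrow> \<exists>d U. 0 < d \<and> d < e \<and> U \<in> lmeasurable \<and>
      S \<inter> ball x d \<subseteq> U \<and> U \<subseteq> ball x d \<and> measure lebesgue U \<le> c * measure lebesgue (ball x d)"
  shows "negligible S"
proof -
  have neg: "negligible (S \<inter> ball 0 R)" for R
  proof (rule negligible_if_outer_measure_contracts[OF _ c])
    fix T :: "'a set"
    assume T: "open T" "T \<in> lmeasurable" "S \<inter> ball 0 R \<subseteq> T"
    define Q where "Q x d U \<longleftrightarrow> 0 < d \<and> ball x d \<subseteq> T \<and> U \<in> lmeasurable \<and> S \<inter> ball x d \<subseteq> U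
       \<and> U \<subseteq> ball x d \<and> measure lebesgue U \<le> c * measure lebesgue (ball x d)" for x d U
    define K where "K = {(x, d). \<exists>U. Q x d U}"
    define V where "V i = (SOME U. Q (fst i) (snd i) U)" for i
    have V: "Q (fst i) (snd i) (V i)" if "i \<in> K" for i
      unfolding V_def by (rule someI_ex) (use that in \<open>auto simp: K_def\<close>)
    obtain C where C: "countable C" "C \<subseteq> K"
       and disj: "pairwise (\<lambda>i j. disjnt (ball (fst i) (snd i)) (ball (fst j) (snd j))) C"
       and neg: "negligible (S \<inter> ball 0 R - (\<Union>i\<in>C. ball (fst i) (snd i)))"
    proof (rule Vitali_covering_theorem_balls[of "S \<inter> ball 0 R" K fst snd])
      fix x and e :: real assume x: "x \<in> S \<inter> ball 0 R" and e: "0 < e"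
      then obtain e' where e': "e' > 0" "ball x e' \<subseteq> T" using T openE by blast
      then obtain d U where "0 < d" "d < min e e'" "U \<in> lmeasurable" "S \<inter> ball x d \<subseteq> U"
          "U \<subseteq> ball x d" "measure lebesgue U \<le> c * measure lebesgue (ball x d)"
        using dens[of x "min e e'"] x e by auto
      then have "Q x d U" using e' by (auto simp: Q_def)
      then show "\<exists>i. i \<in> K \<and> x \<in> ball (fst i) (snd i) \<and> snd i < e"
        using \<open>0 < d\<close> \<open>d < min e e'\<close> by (intro exI[of _ "(x, d)"]) (auto simp: K_def)
    qed blast
    have VC: "ball (fst i) (snd i) \<subseteq> T" "V i \<in> lmeasurable" "S \<inter> ball (fst i) (snd i) \<subseteq> V i"
        "V i \<subseteq> ball (fst i) (snd i)" "measure lebesgue (V i) \<le> c * measure lebesgue (ball (fst i) (snd i))"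
      if "i \<in> C" for i
      using V[of i] C(2) that unfolding Q_def by blast+
    define W where "W = (\<Union>i\<in>C. V i)"
    have VT: "V i \<subseteq> T" "V i \<in> sets lebesgue" if "i \<in> C" for i
      using VC[OF that] by (auto intro: fmeasurableD)
    have Wm: "W \<in> lmeasurable"
      unfolding W_def by (rule fmeasurable_UN[OF C(1) VT T(2)])
    have "measure lebesgue W \<le> c * measure lebesgue T"
      unfolding W_def
    proof (rule measure_UN_bound[OF C(1)])
      show "V i \<in> lmeasurable" if "i \<in> C" for i using VC that by blast
      fix I assume I: "I \<subseteq> C" "finite I"
      have "measure lebesgue (\<Union>i\<in>I. V i) \<le> (\<Sum>i\<in>I. measure lebesgue (V i))"
        by (rule measure_UNION_le) (use I VT in auto)
      also have "\<dots> \<le> (\<Sum>i\<in>I. c * measure lebesgue (ball (fst i) (snd i)))"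
        by (rule sum_mono) (use VC I in blast)
      also have "\<dots> = c * measure lebesgue (\<Union>i\<in>I. ball (fst i) (snd i))"
      proof -
        have "measure lebesgue (\<Union>i\<in>I. ball (fst i) (snd i)) = (\<Sum>i\<in>I. measure lebesgue (ball (fst i) (snd i)))"
        proof (rule measure_finite_Union)
          show "disjoint_family_on (\<lambda>i. ball (fst i) (snd i)) I"
            unfolding disjoint_family_on_def
          proof (intro ballI impI)
            fix i j assume "i \<in> I" "j \<in> I" "i \<noteq> j"
            then have "disjnt (ball (fst i) (snd i)) (ball (fst j) (snd j))"
              using I(1) by (intro pairwiseD[OF disj]) auto
            then show "ball (fst i) (snd i) \<inter> ball (fst j) (snd j) = {}" by (simp add: disjnt_def)
          qed
          show "emeasure lebesgue (ball (fst i) (snd i)) \<noteq> \<infinity>" for i :: "'a \<times> real"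
            using fmeasurableD2[OF lmeasurable_ball] by simp
        qed (use I in auto)
        then show ?thesis by (simp add: sum_distrib_left)
      qed
      also have "\<dots> \<le> c * measure lebesgue T"
      proof (intro mult_left_mono measure_mono_fmeasurable)
        show "(\<Union>i\<in>I. ball (fst i) (snd i)) \<subseteq> T" using VC I by blast
      qed (use T c I in \<open>auto intro!: sets.finite_UN\<close>)
      finally show "measure lebesgue (\<Union>i\<in>I. V i) \<le> c * measure lebesgue T" .
    qed
    moreover have "S \<inter> ball 0 R \<subseteq> W \<union> (S \<inter> ball 0 R - (\<Union>i\<in>C. ball (fst i) (snd i)))"
      using VC(3) unfolding W_def by blast
    moreover have "W \<union> (S \<inter> ball 0 R - (\<Union>i\<in>C. ball (fst i) (snd i))) \<in> lmeasurable"
      using Wm negligible_imp_measurable[OF neg] by (rule fmeasurable.Un)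
    moreover have "measure lebesgue (W \<union> (S \<inter> ball 0 R - (\<Union>i\<in>C. ball (fst i) (snd i)))) = measure lebesgue W"
      using Wm neg by (simp add: negligible_iff_null_sets measure_Un_null_set fmeasurableD)
    ultimately show "\<exists>T'\<in>lmeasurable. S \<inter> ball 0 R \<subseteq> T' \<and> measure lebesgue T' \<le> c * measure lebesgue T"
      by metis
  qed (auto intro: bounded_subset[OF bounded_ball])
  have "S = (\<Union>n::nat. S \<inter> ball 0 (real n))"
    by (auto simp: reals_Archimedean2)
  then show ?thesis
    using negligible_Union_nat[of "\<lambda>n. S \<inter> ball 0 (real n)"] neg by simp
qed

text \<open>At almost every point \<open>x\<close> of a set \<open>E\<close>, every nearby \<open>p\<close> is at distance \<open>o(dist p x)\<close> from \<open>E\<close>.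
  The exceptional points have, at arbitrarily small scales \<open>r\<close>, a ball of radius \<open>\<eta> r\<close> inside
  \<open>ball x (2 r)\<close> that misses \<open>E\<close>.\<close>

lemma negligible_porous_points:
  fixes E :: "'a::euclidean_space set"
  shows "negligible {x \<in> E. \<exists>\<eta>>0. \<forall>\<delta>>0. \<exists>p\<in>ball x \<delta>. \<forall>z\<in>E. \<eta> * dist p x < dist p z}"
    (is "negligible ?P")
proof -
  define S where "S \<eta> = {x \<in> E. \<forall>\<delta>>0. \<exists>p\<in>ball x \<delta>. \<forall>z\<in>E. \<eta> * dist p x < dist p z}" for \<eta> :: real
  have neg: "negligible (S \<eta>)" if \<eta>: "0 < \<eta>" for \<eta>
  proof (cases "\<eta> < 1")
    case False
    \<comment> \<open>The point \<open>x \<in> E\<close> itself is a candidate for \<open>z\<close>.\<close>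
    have "S \<eta> = {}"
    proof (rule ccontr)
      assume "S \<eta> \<noteq> {}"
      then obtain x p where "x \<in> E" "\<eta> * dist p x < dist p x"
        unfolding S_def using zero_less_one by blast
      then show False using False mult_right_mono[of 1 \<eta> "dist p x"] by simp
    qed
    then show ?thesis by simp
  next
    case True
    define q where "q = (\<eta> / 2) ^ DIM('a)"
    have q: "0 < q" "q \<le> 1" using \<eta> True by (auto simp: q_def power_le_one)
    show ?thesis
    proof (rule negligible_if_density_bounded[of "1 - q"])
      fix x and e :: real assume x: "x \<in> S \<eta>" and e: "0 < e"
      then obtain p where p: "dist x p < e / 2" "\<And>z. z \<in> E \<Longrightarrow> \<eta> * dist p x < dist p z"
        unfolding S_def by (fastforce dest!: spec[of _ "e / 2"])
      define r where "r = dist p x"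
      have xE: "x \<in> E" using x by (simp add: S_def)
      have r: "r > 0" using p(2)[OF xE] \<eta> by (cases "p = x") (auto simp: r_def)
      have sub: "ball p (\<eta> * r) \<subseteq> ball x (2 * r)"
      proof
        fix y assume "y \<in> ball p (\<eta> * r)"
        moreover have "\<eta> * r \<le> r" using True r by simp
        ultimately show "y \<in> ball x (2 * r)"
          using dist_triangle[of x y p] by (simp add: r_def dist_commute)
      qed
      have "measure lebesgue (ball p (\<eta> * r)) = q * measure lebesgue (ball x (2 * r))"
        using r \<eta> by (simp add: content_ball q_def power_mult_distrib power_divide)
      then have "measure lebesgue (ball x (2 * r) - ball p (\<eta> * r)) = (1 - q) * measure lebesgue (ball x (2 * r))"
        using sub by (simp add: measurable_measure_Diff algebra_simps)
      moreover have "S \<eta> \<inter> ball x (2 * r) \<subseteq> ball x (2 * r) - ball p (\<eta> * r)"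
        using p(2) by (force simp: S_def r_def)
      ultimately show "\<exists>d U. 0 < d \<and> d < e \<and> U \<in> lmeasurable \<and> S \<eta> \<inter> ball x d \<subseteq> U \<and> U \<subseteq> ball x d
          \<and> measure lebesgue U \<le> (1 - q) * measure lebesgue (ball x d)"
        using r p(1) by (intro exI[of _ "2 * r"] exI[of _ "ball x (2 * r) - ball p (\<eta> * r)"])
          (auto simp: r_def dist_commute fmeasurable_Diff)
    qed (use q in auto)
  qed
  have "?P \<subseteq> (\<Union>n::nat. S (inverse (real (Suc n))))"
  proof
    fix x assume "x \<in> ?P"
    then obtain \<eta> where xE: "x \<in> E" and \<eta>: "\<eta> > 0" "\<forall>\<delta>>0. \<exists>p\<in>ball x \<delta>. \<forall>z\<in>E. \<eta> * dist p x < dist p z"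
      by blast
    obtain n where n: "inverse (real (Suc n)) < \<eta>" using reals_Archimedean[OF \<eta>(1)] by blast
    have "inverse (real (Suc n)) * dist p x \<le> \<eta> * dist p x" for p
      using n by (intro mult_right_mono) auto
    then have "x \<in> S (inverse (real (Suc n)))"
      using xE \<eta>(2) unfolding S_def mem_Collect_eq by (meson order_le_less_trans)
    then show "x \<in> (\<Union>n::nat. S (inverse (real (Suc n))))" by blast
  qed
  moreover have "negligible (\<Union>n::nat. S (inverse (real (Suc n))))"
    by (rule negligible_Union_nat) (auto intro: neg)
  ultimately show ?thesis using negligible_subset by blast
qed

section \<open>Rademacher's theorem\<close>

text \<open>The vector \<open>c\<close> is a directional derivative of \<open>f\<close> at \<open>x\<close> along \<open>w\<close> up to the relative error \<open>\<epsilon>\<close>, also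
  when the base point \<open>p\<close> of the increment moves near \<open>x\<close>. The error is measured against
  \<open>\<bar>t\<bar> + dist p x\<close>, not against \<open>\<bar>t\<bar>\<close> alone; this is what makes the notion available almost everywhere
  for Lipschitz functions.\<close>

definition strict_directional_derivative ::
    "('a::real_normed_vector \<Rightarrow> 'b::real_normed_vector) \<Rightarrow> 'a \<Rightarrow> 'a \<Rightarrow> 'b \<Rightarrow> real \<Rightarrow> bool" where
  "strict_directional_derivative f w x c \<epsilon> \<longleftrightarrow>
     (\<exists>\<delta>>0. \<forall>p t. dist p x < \<delta> \<longrightarrow> \<bar>t\<bar> < \<delta> \<longrightarrow>
        norm (f (p + t *\<^sub>R w) - f p - t *\<^sub>R c) \<le> \<epsilon> * (\<bar>t\<bar> + dist p x))"

text \<open>The points at which the \<open>t\<close>-increments along \<open>w\<close> with \<open>\<bar>t\<bar> < 1 / (n + 1)\<close> are linear with slope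
  \<open>q\<close> up to the relative error \<open>1 / (m + 1)\<close> form a closed set \<open>E n q m\<close>. For each \<open>m\<close> countably many of
  these sets cover almost everything, by the one-dimensional theorem on lines and Fubini. If \<open>x\<close> is not
  an exceptional point of \<open>E n q m\<close> in the sense of \<open>negligible_porous_points\<close>, each \<open>p\<close> near \<open>x\<close> has a close
  neighbour \<open>z\<close> in that set, and the increment at \<open>p\<close> is compared with the one at \<open>z\<close> by the Lipschitz
  condition.\<close>

lemma Lipschitz_strict_directional_derivative_ae:
  fixes f :: "'a::euclidean_space \<Rightarrow> 'b::euclidean_space"
  assumes f: "L-lipschitz_on UNIV f"
  shows "negligible {x. \<not> (\<forall>\<epsilon>>0. \<exists>c. strict_directional_derivative f w x c \<epsilon>)}"
proof -
  have L: "L \<ge> 0" using f by (rule lipschitz_on_nonneg)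
  have contf: "continuous_on S (\<lambda>x. f (g x))" if "continuous_on S g" for S g
    using continuous_on_compose2[OF lipschitz_on_continuous_on[OF f] that] by simp
  obtain D :: "'b set" where D: "countable D"
      and dense: "\<And>X. open X \<Longrightarrow> X \<noteq> {} \<Longrightarrow> \<exists>d\<in>D. d \<in> X"
    using countable_dense_setE by blast
  define E where "E n q m = (\<Inter>t\<in>{t::real. \<bar>t\<bar> < inverse (real (Suc n))}.
      {x. norm (f (x + t *\<^sub>R w) - f x - t *\<^sub>R q) \<le> inverse (real (Suc m)) * \<bar>t\<bar>})" for n q m
  have E_iff: "x \<in> E n q m \<longleftrightarrow> (\<forall>t. \<bar>t\<bar> < inverse (real (Suc n)) \<longrightarrow>
      norm (f (x + t *\<^sub>R w) - f x - t *\<^sub>R q) \<le> inverse (real (Suc m)) * \<bar>t\<bar>)" for x n q m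
    unfolding E_def by blast
  have closedE: "closed (E n q m)" for n q m
    unfolding E_def by (intro closed_INT ballI closed_Collect_le continuous_intros contf)
  define G where "G = (\<Inter>m. \<Union>n. \<Union>q\<in>D. E n q m)"
  have G: "G \<in> sets borel"
  proof -
    have "(\<Union>n. \<Union>q\<in>D. E n q m) \<in> sets borel" for m
    proof -
      have "(\<Union>q\<in>D. E n q m) \<in> sets borel" for n
        using D closedE by (intro sets.countable_UN') (auto intro: borel_closed)
      then show ?thesis by (intro sets.countable_UN') auto
    qed
    then show ?thesis unfolding G_def by (intro sets.countable_INT') auto
  qed
  have in_G: "x + s *\<^sub>R w \<in> G" if diff: "(\<lambda>t. f (x + t *\<^sub>R w)) differentiable (at s)" for x s
    unfolding G_def
  proof
    fix m :: nat
    define e where "e = inverse (real (Suc m)) / 2"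
    have e: "e > 0" by (simp add: e_def)
    obtain c where c: "((\<lambda>t. f (x + t *\<^sub>R w)) has_vector_derivative c) (at s)"
      using diff vector_derivative_works by blast
    then obtain d where d: "d > 0" "\<And>t. \<bar>t - s\<bar> < d \<Longrightarrow>
        norm (f (x + t *\<^sub>R w) - f (x + s *\<^sub>R w) - (t - s) *\<^sub>R c) \<le> e * \<bar>t - s\<bar>"
      using e unfolding has_vector_derivative_def has_derivative_at_alt by (auto simp: real_norm_def)
    obtain q where q: "q \<in> D" "dist c q < e"
      using dense[of "ball c e"] e by auto
    obtain n where n: "inverse (real (Suc n)) < d" using reals_Archimedean[OF d(1)] by blast
    have "x + s *\<^sub>R w \<in> E n q m"
      unfolding E_iff
    proof (intro allI impI)
      fix t :: real assume t: "\<bar>t\<bar> < inverse (real (Suc n))"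
      have "norm (f (x + (s + t) *\<^sub>R w) - f (x + s *\<^sub>R w) - t *\<^sub>R q)
          \<le> norm (f (x + (s + t) *\<^sub>R w) - f (x + s *\<^sub>R w) - t *\<^sub>R c) + norm (t *\<^sub>R c - t *\<^sub>R q)"
        using norm_triangle_ineq[of "f (x + (s + t) *\<^sub>R w) - f (x + s *\<^sub>R w) - t *\<^sub>R c" "t *\<^sub>R c - t *\<^sub>R q"] by simp
      also have "\<dots> \<le> e * \<bar>t\<bar> + e * \<bar>t\<bar>"
      proof (rule add_mono)
        show "norm (f (x + (s + t) *\<^sub>R w) - f (x + s *\<^sub>R w) - t *\<^sub>R c) \<le> e * \<bar>t\<bar>"
          using d(2)[of "s + t"] t n by simp
        have "\<bar>t\<bar> * norm (c - q) \<le> \<bar>t\<bar> * e"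
          using q(2) by (intro mult_left_mono) (auto simp: dist_norm)
        then show "norm (t *\<^sub>R c - t *\<^sub>R q) \<le> e * \<bar>t\<bar>"
          by (simp add: mult.commute flip: scaleR_diff_right)
      qed
      finally show "norm (f (x + s *\<^sub>R w + t *\<^sub>R w) - f (x + s *\<^sub>R w) - t *\<^sub>R q) \<le> inverse (real (Suc m)) * \<bar>t\<bar>"
        by (simp add: e_def scaleR_add_left add.assoc mult.commute flip: distrib_right)
    qed
    then show "x + s *\<^sub>R w \<in> (\<Union>n. \<Union>q\<in>D. E n q m)" using q by blast
  qed
  have "emeasure lborel {t. x + t *\<^sub>R w \<in> - G} = 0" for x
  proof -
    have "negligible {t. \<not> (\<lambda>t. f (x + t *\<^sub>R w)) differentiable (at t)}"
    proof (rule Lipschitz_real_differentiable_ae[of "L * norm w"])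
      show "(L * norm w)-lipschitz_on UNIV (\<lambda>t. f (x + t *\<^sub>R w))"
      proof (rule lipschitz_onI)
        fix s t :: real
        have "dist (f (x + s *\<^sub>R w)) (f (x + t *\<^sub>R w)) \<le> L * dist (x + s *\<^sub>R w) (x + t *\<^sub>R w)"
          by (rule lipschitz_onD[OF f]) auto
        also have "dist (x + s *\<^sub>R w) (x + t *\<^sub>R w) = norm w * dist s t"
          by (simp add: dist_norm mult.commute flip: scaleR_diff_left)
        finally show "dist (f (x + s *\<^sub>R w)) (f (x + t *\<^sub>R w)) \<le> L * norm w * dist s t"
          by simp
      qed (use L in simp)
    qed
    then have "negligible {t. x + t *\<^sub>R w \<in> - G}"
      by (rule negligible_subset) (use in_G in auto)
    moreover have "{t. x + t *\<^sub>R w \<in> - G} \<in> sets borel"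
    proof -
      have "(\<lambda>t. x + t *\<^sub>R w) -` (- G) \<inter> space borel \<in> sets borel"
        by (intro measurable_sets[where A = borel] borel_measurable_continuous_onI continuous_intros) (use G in auto)
      then show ?thesis by (simp add: vimage_def)
    qed
    ultimately show ?thesis
      by (simp add: negligible_iff_null_sets null_sets_completion_iff null_sets_def)
  qed
  then have "emeasure lborel (- G) = 0"
    using G by (subst emeasure_lborel_line_slices[where w = w]) auto
  then have negG: "negligible (- G)"
    using G by (simp add: negligible_iff_null_sets null_sets_completion_iff null_sets_def)
  define P where "P n q m = {x \<in> E n q m. \<exists>\<eta>>0. \<forall>\<delta>>0. \<exists>p\<in>ball x \<delta>. \<forall>z\<in>E n q m. \<eta> * dist p x < dist p z}"
    for n q m
  have negP: "negligible (\<Union>m. \<Union>n. \<Union>q\<in>D. P n q m)"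
    unfolding P_def using negligible_porous_points D
    by (intro negligible_Union_nat negligible_countable_Union) auto
  have "\<exists>c. strict_directional_derivative f w x c \<epsilon>"
    if x: "x \<in> G" "x \<notin> (\<Union>m. \<Union>n. \<Union>q\<in>D. P n q m)" and \<epsilon>: "\<epsilon> > 0" for x \<epsilon>
  proof -
    obtain m where m: "inverse (real (Suc m)) < \<epsilon>" using reals_Archimedean[OF \<epsilon>] by blast
    obtain n q where q: "q \<in> D" "x \<in> E n q m" using x(1) unfolding G_def by blast
    have notP: "x \<notin> P n q m" using x(2) q by blast
    define \<eta> where "\<eta> = \<epsilon> / (2 * L + 1)"
    have \<eta>: "\<eta> > 0" "2 * L * \<eta> \<le> \<epsilon>" using L \<epsilon> by (auto simp: \<eta>_def field_simps)
    obtain \<delta> where \<delta>: "\<delta> > 0" "\<And>p. p \<in> ball x \<delta> \<Longrightarrow> \<exists>z\<in>E n q m. dist p z \<le> \<eta> * dist p x"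
      using notP \<eta>(1) q(2) unfolding P_def by (force simp: not_less)
    show ?thesis
      unfolding strict_directional_derivative_def
    proof (intro exI[of _ q] exI[of _ "min \<delta> (inverse (real (Suc n)))"] conjI allI impI)
      fix p and t :: real
      assume p: "dist p x < min \<delta> (inverse (real (Suc n)))" and t: "\<bar>t\<bar> < min \<delta> (inverse (real (Suc n)))"
      obtain z where z: "z \<in> E n q m" "dist p z \<le> \<eta> * dist p x"
        using \<delta>(2)[of p] p by (auto simp: dist_commute)
      have 1: "norm (f (p + t *\<^sub>R w) - f (z + t *\<^sub>R w)) \<le> L * dist p z"
        using lipschitz_onD[OF f, of "p + t *\<^sub>R w" "z + t *\<^sub>R w"] by (simp add: dist_norm)
      have 2: "norm (f z - f p) \<le> L * dist p z"
        using lipschitz_onD[OF f, of z p] by (simp add: dist_norm dist_commute norm_minus_commute)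
      have 3: "norm (f (z + t *\<^sub>R w) - f z - t *\<^sub>R q) \<le> inverse (real (Suc m)) * \<bar>t\<bar>"
        using z(1) t unfolding E_iff by simp
      have "f (p + t *\<^sub>R w) - f p - t *\<^sub>R q = (f (p + t *\<^sub>R w) - f (z + t *\<^sub>R w)) + (f z - f p)
          + (f (z + t *\<^sub>R w) - f z - t *\<^sub>R q)" by simp
      then have "norm (f (p + t *\<^sub>R w) - f p - t *\<^sub>R q) \<le> L * dist p z + L * dist p z + inverse (real (Suc m)) * \<bar>t\<bar>"
        using norm_triangle_le[OF add_mono[OF norm_triangle_le[OF add_mono[OF 1 2]] 3]] by simp
      also have "L * dist p z \<le> L * (\<eta> * dist p x)" using z(2) L by (rule mult_left_mono)
      also have "inverse (real (Suc m)) * \<bar>t\<bar> \<le> \<epsilon> * \<bar>t\<bar>" using m by (intro mult_right_mono) auto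
      finally have "norm (f (p + t *\<^sub>R w) - f p - t *\<^sub>R q) \<le> (2 * L * \<eta>) * dist p x + \<epsilon> * \<bar>t\<bar>"
        by (simp add: algebra_simps)
      also have "\<dots> \<le> \<epsilon> * dist p x + \<epsilon> * \<bar>t\<bar>" using \<eta>(2) by (simp add: mult_right_mono)
      finally show "norm (f (p + t *\<^sub>R w) - f p - t *\<^sub>R q) \<le> \<epsilon> * (\<bar>t\<bar> + dist p x)"
        by (simp add: algebra_simps)
    qed (use \<delta> in auto)
  qed
  then have "{x. \<not> (\<forall>\<epsilon>>0. \<exists>c. strict_directional_derivative f w x c \<epsilon>)} \<subseteq> - G \<union> (\<Union>m. \<Union>n. \<Union>q\<in>D. P n q m)"
    by blast
  then show ?thesis using negG negP by (meson negligible_Un negligible_subset)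
qed

text \<open>The slopes that belong to errors tending to zero form a Cauchy sequence.\<close>

lemma strict_directional_derivative_limit:
  fixes f :: "'a::real_normed_vector \<Rightarrow> 'b::banach"
  assumes ex: "\<forall>\<epsilon>>0. \<exists>c. strict_directional_derivative f w x c \<epsilon>"
  shows "\<exists>c. \<forall>\<epsilon>>0. strict_directional_derivative f w x c \<epsilon>"
proof -
  define e where "e m = inverse (real (Suc m))" for m
  have epos: "e m > 0" for m by (simp add: e_def)
  have e0: "e \<longlonglongrightarrow> 0" unfolding e_def by (rule LIMSEQ_inverse_real_of_nat)
  have "\<forall>m. \<exists>c. strict_directional_derivative f w x c (e m)"
    using ex epos by blast
  then obtain c where c: "\<And>m. strict_directional_derivative f w x (c m) (e m)"
    by metis
  have near: "norm (c m - c n) \<le> e m + e n" for m n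
  proof -
    obtain d1 d2 where "d1 > 0" "d2 > 0"
      and d1: "\<And>t. \<bar>t\<bar> < d1 \<Longrightarrow> norm (f (x + t *\<^sub>R w) - f x - t *\<^sub>R c m) \<le> e m * \<bar>t\<bar>"
      and d2: "\<And>t. \<bar>t\<bar> < d2 \<Longrightarrow> norm (f (x + t *\<^sub>R w) - f x - t *\<^sub>R c n) \<le> e n * \<bar>t\<bar>"
      using c[of m] c[of n] unfolding strict_directional_derivative_def
      by (metis add.right_neutral dist_self)
    define t where "t = min d1 d2 / 2"
    have t: "t > 0" "\<bar>t\<bar> < d1" "\<bar>t\<bar> < d2" using \<open>d1 > 0\<close> \<open>d2 > 0\<close> by (auto simp: t_def)
    have "t *\<^sub>R (c m - c n) = (f (x + t *\<^sub>R w) - f x - t *\<^sub>R c n) - (f (x + t *\<^sub>R w) - f x - t *\<^sub>R c m)"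
      by (simp add: algebra_simps)
    then have "t * norm (c m - c n) \<le> norm (f (x + t *\<^sub>R w) - f x - t *\<^sub>R c n) + norm (f (x + t *\<^sub>R w) - f x - t *\<^sub>R c m)"
      using t by (metis abs_of_pos norm_scaleR norm_triangle_ineq4)
    also have "\<dots> \<le> t * (e m + e n)" using d1[OF t(2)] d2[OF t(3)] t(1) by (simp add: algebra_simps)
    finally show ?thesis using t(1) by simp
  qed
  have "Cauchy c"
  proof (rule metric_CauchyI)
    fix r :: real assume "r > 0"
    then obtain M where M: "\<And>m. m \<ge> M \<Longrightarrow> e m < r / 2"
      using order_tendstoD(2)[OF e0, of "r / 2"] by (auto simp: eventually_sequentially)
    have "dist (c m) (c n) < r" if "m \<ge> M" "n \<ge> M" for m n
      using near[of m n] M[OF that(1)] M[OF that(2)] by (simp add: dist_norm)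
    then show "\<exists>M. \<forall>m\<ge>M. \<forall>n\<ge>M. dist (c m) (c n) < r" by blast
  qed
  then obtain c0 where c0: "c \<longlonglongrightarrow> c0" using Cauchy_convergent_iff convergent_def by blast
  have lim: "norm (c m - c0) \<le> e m" for m
  proof (rule LIMSEQ_le)
    show "(\<lambda>n. norm (c m - c n)) \<longlonglongrightarrow> norm (c m - c0)" by (intro tendsto_intros c0)
    show "(\<lambda>n. e m + e n) \<longlonglongrightarrow> e m" using tendsto_add[OF tendsto_const e0, of "e m"] by simp
  qed (use near in auto)
  have "strict_directional_derivative f w x c0 \<epsilon>" if \<epsilon>: "\<epsilon> > 0" for \<epsilon>
  proof -
    obtain m where m: "2 * e m < \<epsilon>"
      using reals_Archimedean[of "\<epsilon> / 2"] \<epsilon> unfolding e_def by (metis half_gt_zero mult.commute less_divide_eq_numeral1(1))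
    obtain d where "d > 0" and d: "\<And>p t. dist p x < d \<Longrightarrow> \<bar>t\<bar> < d \<Longrightarrow>
        norm (f (p + t *\<^sub>R w) - f p - t *\<^sub>R c m) \<le> e m * (\<bar>t\<bar> + dist p x)"
      using c[of m] unfolding strict_directional_derivative_def by blast
    show ?thesis
      unfolding strict_directional_derivative_def
    proof (intro exI[of _ d] conjI allI impI)
      fix p t assume pt: "dist p x < d" "\<bar>t\<bar> < d"
      have "f (p + t *\<^sub>R w) - f p - t *\<^sub>R c0 = (f (p + t *\<^sub>R w) - f p - t *\<^sub>R c m) + t *\<^sub>R (c m - c0)"
        by (simp add: algebra_simps)
      then have "norm (f (p + t *\<^sub>R w) - f p - t *\<^sub>R c0)
          \<le> norm (f (p + t *\<^sub>R w) - f p - t *\<^sub>R c m) + \<bar>t\<bar> * norm (c m - c0)"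
        by (metis norm_scaleR norm_triangle_ineq)
      also have "\<dots> \<le> e m * (\<bar>t\<bar> + dist p x) + \<bar>t\<bar> * e m"
        using d[OF pt] lim by (intro add_mono mult_left_mono) auto
      also have "\<dots> \<le> e m * (\<bar>t\<bar> + dist p x) + e m * (\<bar>t\<bar> + dist p x)"
        using epos[of m] by (simp add: algebra_simps)
      also have "\<dots> \<le> \<epsilon> * (\<bar>t\<bar> + dist p x)"
        using mult_right_mono[of "2 * e m" \<epsilon> "\<bar>t\<bar> + dist p x"] m by (simp add: algebra_simps)
      finally show "norm (f (p + t *\<^sub>R w) - f p - t *\<^sub>R c0) \<le> \<epsilon> * (\<bar>t\<bar> + dist p x)" .
    qed (use \<open>d > 0\<close> in auto)
  qed
  then show ?thesis by blast
qed

text \<open>The increment along \<open>h\<close> is telescoped over the coordinates; the moving base point in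
  \<^const>\<open>strict_directional_derivative\<close> is what allows this.\<close>

lemma differentiable_if_strict_directional_derivatives:
  fixes f :: "'a::euclidean_space \<Rightarrow> 'b::real_normed_vector"
  assumes c: "\<And>b \<epsilon>. b \<in> Basis \<Longrightarrow> \<epsilon> > 0 \<Longrightarrow> strict_directional_derivative f b x (c b) \<epsilon>"
  shows "f differentiable (at x)"
proof -
  have part: "\<forall>\<epsilon>>0. \<exists>\<delta>>0. \<forall>h. norm h < \<delta> \<longrightarrow>
      norm (f (x + (\<Sum>b\<in>A. (h \<bullet> b) *\<^sub>R b)) - f x - (\<Sum>b\<in>A. (h \<bullet> b) *\<^sub>R c b)) \<le> \<epsilon> * norm h"
    if "finite A" "A \<subseteq> Basis" for A
    using that
  proof (induction A rule: finite_induct)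
    case empty
    then show ?case by (auto intro: exI[of _ 1])
  next
    case (insert b A)
    have b: "b \<in> Basis" and A: "A \<subseteq> Basis" using insert.prems by auto
    show ?case
    proof (intro allI impI)
      fix \<epsilon> :: real assume \<epsilon>: "\<epsilon> > 0"
      define n where "n = real DIM('a)"
      have n: "n \<ge> 0" by (simp add: n_def)
      define \<epsilon>' where "\<epsilon>' = \<epsilon> / (2 * (1 + n))"
      have \<epsilon>': "\<epsilon>' > 0" using \<epsilon> n by (simp add: \<epsilon>'_def)
      obtain \<delta>1 where \<delta>1: "\<delta>1 > 0" "\<And>p t. dist p x < \<delta>1 \<Longrightarrow> \<bar>t\<bar> < \<delta>1 \<Longrightarrow>
          norm (f (p + t *\<^sub>R b) - f p - t *\<^sub>R c b) \<le> \<epsilon>' * (\<bar>t\<bar> + dist p x)"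
        using c[OF b \<epsilon>'] unfolding strict_directional_derivative_def by blast
      obtain \<delta>2 where \<delta>2: "\<delta>2 > 0" "\<And>h. norm h < \<delta>2 \<Longrightarrow>
          norm (f (x + (\<Sum>b\<in>A. (h \<bullet> b) *\<^sub>R b)) - f x - (\<Sum>b\<in>A. (h \<bullet> b) *\<^sub>R c b)) \<le> \<epsilon> / 2 * norm h"
        using insert.IH[OF A, rule_format, of "\<epsilon> / 2"] \<epsilon> by auto
      show "\<exists>\<delta>>0. \<forall>h. norm h < \<delta> \<longrightarrow> norm (f (x + (\<Sum>b\<in>insert b A. (h \<bullet> b) *\<^sub>R b)) - f x
          - (\<Sum>b\<in>insert b A. (h \<bullet> b) *\<^sub>R c b)) \<le> \<epsilon> * norm h"
      proof (intro exI[of _ "min (\<delta>1 / (1 + n)) \<delta>2"] conjI allI impI)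
        fix h :: 'a assume h: "norm h < min (\<delta>1 / (1 + n)) \<delta>2"
        define p where "p = x + (\<Sum>b\<in>A. (h \<bullet> b) *\<^sub>R b)"
        have hn: "norm h + n * norm h < \<delta>1" using h n by (simp add: field_simps)
        have "dist p x \<le> (\<Sum>b\<in>A. norm h)"
          unfolding p_def dist_norm add_diff_cancel_left'
          by (rule sum_norm_le) (use A Basis_le_norm in \<open>auto simp: subset_iff\<close>)
        also have "\<dots> \<le> n * norm h"
          using card_mono[OF finite_Basis A] by (simp add: n_def mult_right_mono)
        finally have px: "dist p x \<le> n * norm h" .
        have hb: "\<bar>h \<bullet> b\<bar> \<le> norm h" using Basis_le_norm[OF b] .
        have "dist p x < \<delta>1" "\<bar>h \<bullet> b\<bar> < \<delta>1"
          using px hb hn n norm_ge_zero[of h] mult_nonneg_nonneg[OF n norm_ge_zero[of h]] by linarith+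
        then have "norm (f (p + (h \<bullet> b) *\<^sub>R b) - f p - (h \<bullet> b) *\<^sub>R c b) \<le> \<epsilon>' * (\<bar>h \<bullet> b\<bar> + dist p x)"
          by (rule \<delta>1(2))
        also have "\<dots> \<le> \<epsilon>' * (norm h + n * norm h)"
          using px hb \<epsilon>' by (intro mult_left_mono add_mono) auto
        also have "\<dots> = \<epsilon> / 2 * norm h" using n by (simp add: \<epsilon>'_def field_simps)
        finally have 1: "norm (f (p + (h \<bullet> b) *\<^sub>R b) - f p - (h \<bullet> b) *\<^sub>R c b) \<le> \<epsilon> / 2 * norm h" .
        have 2: "norm (f p - f x - (\<Sum>b\<in>A. (h \<bullet> b) *\<^sub>R c b)) \<le> \<epsilon> / 2 * norm h"
          using \<delta>2(2)[of h] h by (simp add: p_def)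
        have eq: "f (x + (\<Sum>b\<in>insert b A. (h \<bullet> b) *\<^sub>R b)) - f x - (\<Sum>b\<in>insert b A. (h \<bullet> b) *\<^sub>R c b)
            = (f (p + (h \<bullet> b) *\<^sub>R b) - f p - (h \<bullet> b) *\<^sub>R c b) + (f p - f x - (\<Sum>b\<in>A. (h \<bullet> b) *\<^sub>R c b))"
          using insert.hyps by (simp add: p_def algebra_simps)
        show "norm (f (x + (\<Sum>b\<in>insert b A. (h \<bullet> b) *\<^sub>R b)) - f x - (\<Sum>b\<in>insert b A. (h \<bullet> b) *\<^sub>R c b)) \<le> \<epsilon> * norm h"
          unfolding eq using norm_triangle_le[OF add_mono[OF 1 2]] by (simp only: field_sum_of_halves flip: distrib_right)
      qed (use \<delta>1 \<delta>2 n in auto)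
    qed
  qed
  have "(f has_derivative (\<lambda>h. \<Sum>b\<in>Basis. (h \<bullet> b) *\<^sub>R c b)) (at x)"
    unfolding has_derivative_at_alt
  proof (intro conjI allI impI)
    show "bounded_linear (\<lambda>h. \<Sum>b\<in>Basis. (h \<bullet> b) *\<^sub>R c b)"
      by (intro bounded_linear_sum bounded_linear_scaleR_const bounded_linear_inner_left)
    fix e :: real assume "e > 0"
    then obtain d where "d > 0" "\<And>h. norm h < d \<Longrightarrow> norm (f (x + h) - f x - (\<Sum>b\<in>Basis. (h \<bullet> b) *\<^sub>R c b)) \<le> e * norm h"
      using part[of Basis, OF finite_Basis subset_refl] by (auto simp: euclidean_representation)
    then show "\<exists>d>0. \<forall>y. norm (y - x) < d \<longrightarrow> norm (f y - f x - (\<Sum>b\<in>Basis. ((y - x) \<bullet> b) *\<^sub>R c b)) \<le> e * norm (y - x)"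
      by (intro exI[of _ d]) (metis add.commute diff_add_cancel)
  qed
  then show ?thesis by (rule differentiableI)
qed

theorem Rademacher:
  fixes f :: "'a::euclidean_space \<Rightarrow> 'b::euclidean_space"
  assumes f: "L-lipschitz_on UNIV f"
  shows "negligible {x. \<not> f differentiable (at x)}"
proof -
  have "negligible (\<Union>b\<in>Basis. {x. \<not> (\<forall>\<epsilon>>0. \<exists>c. strict_directional_derivative f b x c \<epsilon>)})"
    using Lipschitz_strict_directional_derivative_ae[OF f] by (intro negligible_Union) auto
  moreover have "f differentiable (at x)"
    if "\<And>b. b \<in> Basis \<Longrightarrow> \<forall>\<epsilon>>0. \<exists>c. strict_directional_derivative f b x c \<epsilon>" for x
  proof -
    have "\<exists>c. \<forall>\<epsilon>>0. strict_directional_derivative f b x c \<epsilon>" if "b \<in> Basis" for b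
      using strict_directional_derivative_limit \<open>\<And>b. b \<in> Basis \<Longrightarrow> _\<close> that by blast
    then obtain c where "\<And>b. b \<in> Basis \<Longrightarrow> \<forall>\<epsilon>>0. strict_directional_derivative f b x (c b) \<epsilon>"
      by metis
    then show ?thesis using differentiable_if_strict_directional_derivatives by blast
  qed
  ultimately show ?thesis by (elim negligible_subset) blast
qed

section \<open>From derivative bounds to increments\<close>

text \<open>A Zygmund-type lemma that replaces the fundamental theorem of calculus: almost everywhere
  differentiability of \<open>\<phi>\<close> is not needed. After subtracting \<open>\<epsilon> t\<close>, suppose the result \<open>\<psi>\<close> increased from \<open>a\<close> to
  \<open>b\<close>. Its image of the null set \<open>N\<close> is null, so some value \<open>y\<close> between \<open>\<psi> a\<close> and \<open>\<psi> b\<close> is not attained on \<open>N\<close>;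
  at the last time at which \<open>\<psi>\<close> is at most \<open>y\<close> the assumption on increments is violated.\<close>

lemma nonincreasing_if_upper_derivative_nonpos_ae:
  fixes \<phi> :: "real \<Rightarrow> real"
  assumes ab: "a \<le> b"
    and lip: "\<And>t. t \<in> {a..b} \<Longrightarrow> \<exists>d>0. \<exists>L. \<forall>s\<in>{a..b}. \<bar>s - t\<bar> < d \<longrightarrow> \<bar>\<phi> s - \<phi> t\<bar> \<le> L * \<bar>s - t\<bar>"
    and N: "negligible N"
    and dini: "\<And>t \<epsilon>. \<lbrakk>t \<in> {a..<b}; t \<notin> N; 0 < \<epsilon>\<rbrakk> \<Longrightarrow>
      \<exists>\<delta>>0. \<forall>h. 0 < h \<and> h < \<delta> \<longrightarrow> \<phi> (t + h) - \<phi> t \<le> \<epsilon> * h"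
  shows "\<phi> b \<le> \<phi> a"
proof -
  have strict: "\<phi> b - \<epsilon> * b \<le> \<phi> a - \<epsilon> * a" if \<epsilon>: "\<epsilon> > 0" for \<epsilon>
  proof (rule ccontr)
    define \<psi> where "\<psi> t = \<phi> t - \<epsilon> * t" for t
    assume "\<not> ?thesis"
    then have less: "\<psi> a < \<psi> b" by (simp add: \<psi>_def)
    have lip\<psi>: "\<exists>d>0. \<exists>L\<ge>0. \<forall>s\<in>{a..b}. \<bar>s - t\<bar> < d \<longrightarrow> \<bar>\<psi> s - \<psi> t\<bar> \<le> L * \<bar>s - t\<bar>" if t: "t \<in> {a..b}" for t
    proof -
      obtain d L where d: "d > 0" "\<And>s. s \<in> {a..b} \<Longrightarrow> \<bar>s - t\<bar> < d \<Longrightarrow> \<bar>\<phi> s - \<phi> t\<bar> \<le> L * \<bar>s - t\<bar>"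
        using lip[OF t] by blast
      have "\<bar>\<psi> s - \<psi> t\<bar> \<le> (\<bar>L\<bar> + \<epsilon>) * \<bar>s - t\<bar>" if s: "s \<in> {a..b}" "\<bar>s - t\<bar> < d" for s
      proof -
        have "\<psi> s - \<psi> t = (\<phi> s - \<phi> t) - \<epsilon> * (s - t)" by (simp add: \<psi>_def algebra_simps)
        then have "\<bar>\<psi> s - \<psi> t\<bar> \<le> \<bar>\<phi> s - \<phi> t\<bar> + \<epsilon> * \<bar>s - t\<bar>"
          using \<epsilon> abs_triangle_ineq4[of "\<phi> s - \<phi> t" "\<epsilon> * (s - t)"] by (simp add: abs_mult)
        also have "\<dots> \<le> \<bar>L\<bar> * \<bar>s - t\<bar> + \<epsilon> * \<bar>s - t\<bar>"
          using d(2)[OF s] mult_right_mono[OF abs_ge_self[of L] abs_ge_zero[of "s - t"]] by linarith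
        finally show ?thesis by (simp add: algebra_simps)
      qed
      then show ?thesis using d(1) \<epsilon> by (intro exI[of _ d] conjI exI[of _ "\<bar>L\<bar> + \<epsilon>"]) auto
    qed
    have cont: "continuous_on {a..b} \<psi>"
      unfolding continuous_on_iff
    proof (intro ballI allI impI)
      fix t e :: real assume t: "t \<in> {a..b}" and e: "e > 0"
      obtain d L where d: "d > 0" "L \<ge> 0" "\<And>s. s \<in> {a..b} \<Longrightarrow> \<bar>s - t\<bar> < d \<Longrightarrow> \<bar>\<psi> s - \<psi> t\<bar> \<le> L * \<bar>s - t\<bar>"
        using lip\<psi>[OF t] by blast
      have "\<bar>\<psi> s - \<psi> t\<bar> < e" if s: "s \<in> {a..b}" "\<bar>s - t\<bar> < min d (e / (L + 1))" for s
      proof -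
        have "\<bar>\<psi> s - \<psi> t\<bar> \<le> L * \<bar>s - t\<bar>" using d(3) s by simp
        also have "\<dots> \<le> L * (e / (L + 1))" using s d(2) by (intro mult_left_mono) auto
        also have "\<dots> < e" using d(2) e by (simp add: field_simps)
        finally show ?thesis .
      qed
      then show "\<exists>d>0. \<forall>x'\<in>{a..b}. dist x' t < d \<longrightarrow> dist (\<psi> x') (\<psi> t) < e"
        using d e by (intro exI[of _ "min d (e / (L + 1))"]) (auto simp: dist_real_def)
    qed
    have "negligible (\<psi> ` (N \<inter> {a..b}))"
    proof (rule negligible_locally_Lipschitz_image)
      show "negligible (N \<inter> {a..b})" using N by (rule negligible_subset) auto
      fix t assume "t \<in> N \<inter> {a..b}"
      then obtain d L where "d > 0" "\<And>s. s \<in> {a..b} \<Longrightarrow> \<bar>s - t\<bar> < d \<Longrightarrow> \<bar>\<psi> s - \<psi> t\<bar> \<le> L * \<bar>s - t\<bar>"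
        using lip\<psi>[of t] by blast
      then show "\<exists>T B. open T \<and> t \<in> T \<and> (\<forall>s\<in>N \<inter> {a..b} \<inter> T. norm (\<psi> s - \<psi> t) \<le> B * norm (s - t))"
        by (intro exI[of _ "ball t d"] exI[of _ L]) (auto simp: dist_real_def abs_minus_commute)
    qed simp
    moreover have "\<not> negligible {\<psi> a<..<\<psi> b}"
      using less open_not_negligible[of "{\<psi> a<..<\<psi> b}"] by simp
    ultimately obtain y where y: "\<psi> a < y" "y < \<psi> b" "y \<notin> \<psi> ` (N \<inter> {a..b})"
      by (meson greaterThanLessThan_iff negligible_subset subsetI)
    define A where "A = {t \<in> {a..b}. \<psi> t \<le> y}"
    have "compact A"
    proof -
      have "closed A" unfolding A_def using continuous_closed_preimage[OF cont closed_atLeastAtMost closed_atMost[of y]] by (simp add: vimage_def Int_def)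
      then show ?thesis by (auto simp: A_def compact_eq_bounded_closed intro: bounded_subset[of "{a..b}"])
    qed
    moreover have "A \<noteq> {}" using y ab by (auto simp: A_def)
    ultimately obtain t where t: "t \<in> A" "\<And>s. s \<in> A \<Longrightarrow> s \<le> t"
      using compact_attains_sup[of A] by blast
    have tb: "t < b" using t(1) y by (cases "t = b") (auto simp: A_def)
    have gt: "\<psi> s > y" if "t < s" "s \<le> b" for s
    proof (rule ccontr)
      assume "\<not> \<psi> s > y"
      then have "s \<in> A" using that t(1) by (auto simp: A_def)
      then show False using t(2)[of s] that(1) by simp
    qed
    have "\<psi> t = y"
    proof (rule ccontr)
      assume "\<psi> t \<noteq> y"
      then have "\<psi> t < y" using t(1) by (simp add: A_def)
      then obtain s where s: "t \<le> s" "s \<le> b" "\<psi> s = y"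
        using IVT'[of \<psi> t y b] y tb continuous_on_subset[OF cont, of "{t..b}"] t(1) by (auto simp: A_def)
      then show False using gt[of s] \<open>\<psi> t < y\<close> by (cases "s = t") auto
    qed
    then have "t \<notin> N" "t \<in> {a..<b}" using y(3) t(1) tb by (auto simp: A_def)
    then obtain \<delta> where \<delta>: "\<delta> > 0" "\<And>h. 0 < h \<Longrightarrow> h < \<delta> \<Longrightarrow> \<phi> (t + h) - \<phi> t \<le> \<epsilon> * h"
      using dini[of t \<epsilon>] \<epsilon> by blast
    define h where "h = min \<delta> (b - t) / 2"
    have "h \<le> \<delta> / 2" "h > 0" using \<delta>(1) tb by (auto simp: h_def)
    moreover have "2 * h \<le> b - t" by (simp add: h_def)
    ultimately have h: "h > 0" "h < \<delta>" "t + h \<le> b" by auto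
    have "\<psi> (t + h) \<le> \<psi> t" using \<delta>(2)[OF h(1,2)] by (simp add: \<psi>_def algebra_simps)
    then show False using gt[of "t + h"] h \<open>\<psi> t = y\<close> by simp
  qed
  show ?thesis
  proof (rule field_le_epsilon)
    fix e :: real assume e: "e > 0"
    show "\<phi> b \<le> \<phi> a + e"
    proof (cases "a = b")
      case False
      define c where "c = e / (b - a)"
      have "c > 0" "c * (b - a) = e" using False e ab by (simp_all add: c_def)
      then have "c > 0" "c * b - c * a = e" by (simp_all only: right_diff_distrib)
      then show ?thesis using strict[of c] by linarith
    qed (use e in simp)
  qed
qed

text \<open>By Rademacher's theorem and Fubini, \<open>F\<close> is differentiable at almost all points of almost every
  line parallel to \<open>w\<close>. On such a line the derivative bound integrates; the segment starting at \<open>y0\<close> is a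
  limit of segments of such lines.\<close>

lemma Lipschitz_directional_mean_value:
  fixes F :: "'a::euclidean_space \<Rightarrow> 'b::euclidean_space"
  assumes F: "L-lipschitz_on UNIV F" and \<delta>: "0 < \<delta>"
    and bound: "\<And>y D. \<lbrakk>dist y y0 < \<delta>; (F has_derivative D) (at y)\<rbrakk> \<Longrightarrow> u \<bullet> D w \<le> c"
    and s: "0 \<le> s" "s * norm w < \<delta>"
  shows "u \<bullet> (F (y0 + s *\<^sub>R w) - F y0) \<le> c * s"
proof -
  have L: "L \<ge> 0" using F by (rule lipschitz_on_nonneg)
  have negF: "negligible {x. \<not> F differentiable (at x)}" by (rule Rademacher[OF F])
  then obtain N where N: "N \<in> sets borel" "{x. \<not> F differentiable (at x)} \<subseteq> N" "emeasure lborel N = 0"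
  proof -
    have "{x. \<not> F differentiable (at x)} \<in> null_sets (completion lborel)"
      using negF by (simp add: negligible_iff_null_sets)
    then obtain N where "N \<in> null_sets lborel" "{x. \<not> F differentiable (at x)} \<subseteq> N"
      unfolding null_sets_completion_iff2 by blast
    then show thesis by (intro that) auto
  qed
  have ae: "AE z in lborel. emeasure lborel {t::real. z + t *\<^sub>R w \<in> N} = 0"
    using emeasure_lborel_line_slices[OF N(1), of w] N(3) by blast
  have near: "u \<bullet> (F (z + s *\<^sub>R w) - F z) \<le> c * s"
    if z: "emeasure lborel {t::real. z + t *\<^sub>R w \<in> N} = 0" "dist z y0 + s * norm w < \<delta>" for z
  proof -
    define \<phi> where "\<phi> t = u \<bullet> F (z + t *\<^sub>R w) - c * t" for t
    have "\<phi> s \<le> \<phi> 0"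
    proof (rule nonincreasing_if_upper_derivative_nonpos_ae[OF s(1)])
      fix t
      have "\<bar>\<phi> r - \<phi> t\<bar> \<le> (norm u * L * norm w + \<bar>c\<bar>) * \<bar>r - t\<bar>" for r
      proof -
        have "norm (F (z + r *\<^sub>R w) - F (z + t *\<^sub>R w)) \<le> L * (norm w * \<bar>r - t\<bar>)"
          using lipschitz_onD[OF F, of "z + r *\<^sub>R w" "z + t *\<^sub>R w"]
          by (simp add: dist_norm mult.commute flip: scaleR_diff_left)
        then have "\<bar>u \<bullet> (F (z + r *\<^sub>R w) - F (z + t *\<^sub>R w))\<bar> \<le> norm u * (L * (norm w * \<bar>r - t\<bar>))"
          by (meson Cauchy_Schwarz_ineq2 mult_left_mono norm_ge_zero order_trans)
        moreover have "\<phi> r - \<phi> t = u \<bullet> (F (z + r *\<^sub>R w) - F (z + t *\<^sub>R w)) - c * (r - t)"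
          by (simp add: \<phi>_def algebra_simps inner_diff_right)
        moreover have "\<bar>c * (r - t)\<bar> = \<bar>c\<bar> * \<bar>r - t\<bar>" by (rule abs_mult)
        moreover have "norm u * (L * (norm w * \<bar>r - t\<bar>)) + \<bar>c\<bar> * \<bar>r - t\<bar> = (norm u * L * norm w + \<bar>c\<bar>) * \<bar>r - t\<bar>"
          by (simp add: distrib_right)
        ultimately show ?thesis
          using abs_triangle_ineq4[of "u \<bullet> (F (z + r *\<^sub>R w) - F (z + t *\<^sub>R w))" "c * (r - t)"]
          by linarith
      qed
      then show "\<exists>d>0. \<exists>L. \<forall>r\<in>{0..s}. \<bar>r - t\<bar> < d \<longrightarrow> \<bar>\<phi> r - \<phi> t\<bar> \<le> L * \<bar>r - t\<bar>"
        using zero_less_one by blast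
    next
      have "{t. z + t *\<^sub>R w \<in> N} \<in> sets borel"
      proof -
        have "(\<lambda>t. z + t *\<^sub>R w) -` N \<inter> space borel \<in> sets borel"
          by (intro measurable_sets[OF _ N(1)] borel_measurable_continuous_onI continuous_intros)
        then show ?thesis by (simp add: vimage_def)
      qed
      then show "negligible {t. z + t *\<^sub>R w \<in> N}"
        using z(1) by (simp add: negligible_iff_null_sets null_sets_completion_iff null_sets_def)
    next
      fix t \<epsilon> :: real assume t: "t \<in> {0..<s}" "t \<notin> {t. z + t *\<^sub>R w \<in> N}" and \<epsilon>: "0 < \<epsilon>"
      define y where "y = z + t *\<^sub>R w"
      have "F differentiable (at y)" using t(2) N(2) by (auto simp: y_def)
      then obtain D where D: "(F has_derivative D) (at y)" by (auto simp: differentiable_def)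
      have "t * norm w \<le> s * norm w" using t(1) by (intro mult_right_mono) auto
      moreover have "dist y y0 \<le> dist z y0 + t * norm w"
        using dist_triangle[of y y0 z] t(1) by (simp add: y_def dist_norm)
      ultimately have "dist y y0 < \<delta>" using z(2) by simp
      then have Dw: "u \<bullet> D w \<le> c" by (rule bound[OF _ D])
      have "((\<lambda>r. z + r *\<^sub>R w) has_derivative (\<lambda>h. h *\<^sub>R w)) (at t)"
        by (auto intro!: derivative_eq_intros)
      from has_derivative_compose[OF this, of F D] D
      have "((\<lambda>r. F (z + r *\<^sub>R w)) has_derivative (\<lambda>h. D (h *\<^sub>R w))) (at t)"
        by (simp add: y_def)
      then have "((\<lambda>r. u \<bullet> F (z + r *\<^sub>R w)) has_derivative (\<lambda>h. u \<bullet> D (h *\<^sub>R w))) (at t)"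
        by (rule has_derivative_inner_right)
      moreover have "D (h *\<^sub>R w) = h *\<^sub>R D w" for h
        using has_derivative_linear[OF D] by (simp add: linear_scale)
      ultimately have "((\<lambda>r. u \<bullet> F (z + r *\<^sub>R w)) has_derivative (\<lambda>h. h * (u \<bullet> D w))) (at t)"
        by simp
      then obtain d where d: "d > 0" "\<And>r. \<bar>r - t\<bar> < d \<Longrightarrow>
          \<bar>u \<bullet> F (z + r *\<^sub>R w) - u \<bullet> F (z + t *\<^sub>R w) - (r - t) * (u \<bullet> D w)\<bar> \<le> \<epsilon> * \<bar>r - t\<bar>"
        using \<epsilon> unfolding has_derivative_at_alt by (auto simp: real_norm_def)
      show "\<exists>\<delta>>0. \<forall>h. 0 < h \<and> h < \<delta> \<longrightarrow> \<phi> (t + h) - \<phi> t \<le> \<epsilon> * h"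
      proof (intro exI[of _ d] conjI allI impI)
        fix h assume h: "0 < h \<and> h < d"
        have "h * (u \<bullet> D w) \<le> h * c" using Dw h by (intro mult_left_mono) auto
        moreover have "u \<bullet> F (z + (t + h) *\<^sub>R w) - u \<bullet> F (z + t *\<^sub>R w) - h * (u \<bullet> D w) \<le> \<epsilon> * h"
          using d(2)[of "t + h"] h by (simp add: abs_le_iff)
        moreover have "\<phi> (t + h) - \<phi> t
            = u \<bullet> F (z + (t + h) *\<^sub>R w) - u \<bullet> F (z + t *\<^sub>R w) - h * c"
          by (simp add: \<phi>_def distrib_left mult.commute)
        ultimately show "\<phi> (t + h) - \<phi> t \<le> \<epsilon> * h" by linarith
      qed (rule d(1))
    qed
    then show ?thesis by (simp add: \<phi>_def inner_diff_right)
  qed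
  show ?thesis
  proof (rule field_le_epsilon)
    fix e :: real assume e: "e > 0"
    define r where "r = min (\<delta> - s * norm w) (e / (2 * norm u * L + 1))"
    have den: "2 * norm u * L + 1 > 0" using L by (simp add: add_nonneg_pos)
    have r: "r > 0" using e s den by (simp add: r_def)
    have "\<exists>z\<in>ball y0 r. emeasure lborel {t::real. z + t *\<^sub>R w \<in> N} = 0"
    proof (rule ccontr)
      assume *: "\<not> ?thesis"
      have "AE z in lborel. z \<notin> ball y0 r" using ae by (rule AE_mp) (use * in auto)
      then have "ball y0 r \<in> null_sets lborel" by (simp add: AE_iff_null_sets)
      then have "negligible (ball y0 r)" by (simp add: negligible_iff_null_sets null_sets_completionI)
      then show False using r open_not_negligible[of "ball y0 r"] by simp
    qed
    then obtain z where z: "dist y0 z < r" "emeasure lborel {t::real. z + t *\<^sub>R w \<in> N} = 0" by auto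
    have 1: "u \<bullet> (F (z + s *\<^sub>R w) - F z) \<le> c * s"
      by (rule near[OF z(2)]) (use z(1) in \<open>simp add: r_def dist_commute\<close>)
    have 2: "u \<bullet> (F (y0 + v) - F (z + v)) \<le> norm u * (L * r)" for v
    proof -
      have "u \<bullet> (F (y0 + v) - F (z + v)) \<le> norm u * norm (F (y0 + v) - F (z + v))"
        by (rule norm_cauchy_schwarz)
      also have "norm (F (y0 + v) - F (z + v)) \<le> L * dist y0 z"
        using lipschitz_onD[OF F, of "y0 + v" "z + v"] by (simp add: dist_norm)
      also have "\<dots> \<le> L * r" using z(1) L by (intro mult_left_mono) auto
      finally show ?thesis by (simp add: mult_left_mono)
    qed
    have 3: "u \<bullet> (F z - F y0) \<le> norm u * (L * r)"
    proof -
      have "u \<bullet> (F z - F y0) \<le> norm u * norm (F z - F y0)"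
        by (rule norm_cauchy_schwarz)
      also have "norm (F z - F y0) \<le> L * dist y0 z"
        using lipschitz_onD[OF F, of z y0] by (simp add: dist_norm norm_minus_commute)
      also have "\<dots> \<le> L * r" using z(1) L by (intro mult_left_mono) auto
      finally show ?thesis by (simp add: mult_left_mono)
    qed
    have "u \<bullet> (F (y0 + s *\<^sub>R w) - F y0) \<le> c * s + (2 * norm u * L) * r"
      using 1 2[of "s *\<^sub>R w"] 3 by (simp add: inner_diff_right)
    also have "(2 * norm u * L) * r \<le> (2 * norm u * L + 1) * (e / (2 * norm u * L + 1))"
      using L r by (intro mult_mono) (auto simp: r_def)
    also have "\<dots> = e" using den by simp
    finally show "u \<bullet> (F (y0 + s *\<^sub>R w) - F y0) \<le> c * s + e" by simp
  qed
qed

section \<open>Clarke Jacobians and increments along paths\<close>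

lemma has_derivative_norm_le_Lipschitz:
  fixes f :: "'a::real_normed_vector \<Rightarrow> 'b::real_normed_vector"
  assumes D: "(f has_derivative D) (at y)" and S: "open S" "y \<in> S" and lip: "L-lipschitz_on S f"
  shows "norm (D h) \<le> L * norm h"
proof (cases "h = 0")
  case True
  then show ?thesis using has_derivative_linear[OF D] by (simp add: linear_0)
next
  case False
  show ?thesis
  proof (rule field_le_epsilon)
    fix e :: real assume e: "e > 0"
    have "e / norm h > 0" using e False by simp
    then obtain d where d: "d > 0" "\<And>z. norm (z - y) < d \<Longrightarrow> norm (f z - f y - D (z - y)) \<le> e / norm h * norm (z - y)"
      using D unfolding has_derivative_at_alt by blast
    obtain r where r: "r > 0" "ball y r \<subseteq> S" using S openE by blast
    define t where "t = min d r / (2 * norm h)"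
    have t: "t > 0" "t * norm h < d" "t * norm h < r" using d(1) r(1) False by (auto simp: t_def min_def)
    have "y + t *\<^sub>R h \<in> S" using r(2) t by (auto simp: dist_norm)
    then have 1: "norm (f (y + t *\<^sub>R h) - f y) \<le> L * (t * norm h)"
      using lipschitz_onD[OF lip _ S(2), of "y + t *\<^sub>R h"] t by (simp add: dist_norm)
    have "norm (f (y + t *\<^sub>R h) - f y - D (t *\<^sub>R h)) \<le> e / norm h * (t * norm h)"
      using d(2)[of "y + t *\<^sub>R h"] t by simp
    then have 2: "norm (f (y + t *\<^sub>R h) - f y - D (t *\<^sub>R h)) \<le> e * t" using False by simp
    have "norm (D (t *\<^sub>R h)) \<le> norm (f (y + t *\<^sub>R h) - f y) + norm (f (y + t *\<^sub>R h) - f y - D (t *\<^sub>R h))"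
      using norm_triangle_ineq4[of "f (y + t *\<^sub>R h) - f y" "f (y + t *\<^sub>R h) - f y - D (t *\<^sub>R h)"] by simp
    moreover have "norm (D (t *\<^sub>R h)) = t * norm (D h)"
      using has_derivative_linear[OF D] t by (simp add: linear_scale)
    ultimately have "t * norm (D h) \<le> t * (L * norm h + e)" using 1 2 by (simp add: algebra_simps)
    then show "norm (D h) \<le> L * norm h + e" using t by simp
  qed
qed

lemma norm_matrix_le_operator_bound:
  fixes A :: "real ^ 'n ^ 'm"
  assumes A: "\<And>h. norm (A *v h) \<le> L * norm h"
  shows "norm A \<le> real CARD('m) * (real CARD('n) * L)"
proof -
  have comp: "\<bar>A $ i $ j\<bar> \<le> L" for i j
  proof -
    have "\<bar>A $ i $ j\<bar> = \<bar>(A *v axis j 1) $ i\<bar>" by (simp add: matrix_vector_mult_basis column_def)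
    also have "\<dots> \<le> norm (A *v axis j 1)" by (rule component_le_norm_cart)
    also have "\<dots> \<le> L" using A[of "axis j 1"] by (simp add: norm_axis_1)
    finally show ?thesis .
  qed
  have "norm (A $ i) \<le> real CARD('n) * L" for i
    using norm_le_l1_cart[of "A $ i"] sum_bounded_above[of UNIV "\<lambda>j. \<bar>A $ i $ j\<bar>" L] comp[of i] by simp
  then show ?thesis
    using L2_set_le_sum[of UNIV "\<lambda>i. norm (A $ i)"] sum_bounded_above[of UNIV "\<lambda>i. norm (A $ i)" "real CARD('n) * L"]
    by (simp add: norm_vec_def)
qed

text \<open>Jacobians near \<open>y0\<close> are bounded in terms of the Lipschitz constant, so a sequence violating the
  conclusion has a subsequence whose Jacobians converge, and the limit belongs to the Clarke Jacobian.\<close>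

lemma clarke_jacobian_upper_semicontinuous:
  fixes f :: "real ^ 'n \<Rightarrow> real ^ 'm"
  assumes lip: "L-lipschitz_on (ball y0 r) f" and r: "0 < r" "ball y0 r \<subseteq> U"
    and bound: "\<And>M. M \<in> clarke_jacobian U f y0 \<Longrightarrow> u \<bullet> (M *v w) \<le> c" and \<epsilon>: "0 < \<epsilon>"
  shows "\<exists>\<delta>>0. \<forall>y. dist y y0 < \<delta> \<longrightarrow> f differentiable (at y) \<longrightarrow> u \<bullet> (jacobian f (at y) *v w) \<le> c + \<epsilon>"
proof (rule ccontr)
  assume neg: "\<not> ?thesis"
  have "\<forall>n. \<exists>y. dist y y0 < min r (inverse (real (Suc n))) \<and> f differentiable (at y) \<and>
      c + \<epsilon> < u \<bullet> (jacobian f (at y) *v w)"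
  proof
    fix n
    have "min r (inverse (real (Suc n))) > 0" using r by simp
    then show "\<exists>y. dist y y0 < min r (inverse (real (Suc n))) \<and> f differentiable (at y) \<and>
      c + \<epsilon> < u \<bullet> (jacobian f (at y) *v w)" using neg by (meson not_le)
  qed
  then obtain Y where Y: "\<And>n. dist (Y n) y0 < min r (inverse (real (Suc n)))"
      "\<And>n. f differentiable (at (Y n))" "\<And>n. c + \<epsilon> < u \<bullet> (jacobian f (at (Y n)) *v w)"
    by metis
  have Yball: "Y n \<in> ball y0 r" for n using Y(1)[of n] by (simp add: dist_commute)
  have Ylim: "Y \<longlonglongrightarrow> y0"
  proof (rule metric_tendsto_imp_tendsto[OF LIMSEQ_inverse_real_of_nat], rule always_eventually, rule allI)
    show "dist (Y n) y0 \<le> dist (inverse (real (Suc n))) 0" for n using Y(1)[of n] by simp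
  qed
  define J where "J n = jacobian f (at (Y n))" for n
  have "norm (J n) \<le> real CARD('m) * (real CARD('n) * L)" for n
  proof (rule norm_matrix_le_operator_bound)
    fix h
    have "(f has_derivative (\<lambda>h. J n *v h)) (at (Y n))"
      using Y(2)[of n] unfolding J_def jacobian_works .
    from has_derivative_norm_le_Lipschitz[OF this open_ball Yball lip]
    show "norm (J n *v h) \<le> L * norm h" .
  qed
  then have "bounded (range J)" by (auto simp: bounded_iff)
  then obtain M k where k: "strict_mono k" "(J \<circ> k) \<longlonglongrightarrow> M"
    using bounded_imp_convergent_subsequence by blast
  have "M \<in> clarke_jacobian U f y0"
    unfolding clarke_jacobian_def
  proof (rule hull_inc, rule CollectI, intro exI[of _ "Y \<circ> k"] conjI allI)
    show "(Y \<circ> k) \<longlonglongrightarrow> y0" using LIMSEQ_subseq_LIMSEQ[OF Ylim k(1)] .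
    show "(Y \<circ> k) n \<in> U" for n using Yball r(2) by auto
    show "f differentiable (at ((Y \<circ> k) n))" for n using Y(2) by simp
    show "(\<lambda>n. jacobian f (at ((Y \<circ> k) n))) \<longlonglongrightarrow> M" using k(2) by (simp add: J_def comp_def)
  qed
  then have le: "u \<bullet> (M *v w) \<le> c" by (rule bound)
  have "linear (\<lambda>A :: real ^ 'n ^ 'm. u \<bullet> (A *v w))"
    by (rule linearI) (simp_all add: matrix_vector_mult_add_rdistrib inner_add_right flip: scaleR_matrix_vector_assoc)
  then have "bounded_linear (\<lambda>A :: real ^ 'n ^ 'm. u \<bullet> (A *v w))"
    by (simp add: linear_conv_bounded_linear)
  from bounded_linear.tendsto[OF this k(2)]
  have "(\<lambda>n. u \<bullet> ((J \<circ> k) n *v w)) \<longlonglongrightarrow> u \<bullet> (M *v w)" .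
  then have "c + \<epsilon> \<le> u \<bullet> (M *v w)"
    by (rule LIMSEQ_le_const) (use Y(3) in \<open>auto simp: J_def less_imp_le\<close>)
  then show False using le \<epsilon> by simp
qed

lemma locally_lipschitz_onE:
  assumes "locally_lipschitz_on U f" "open U" "y \<in> U"
  obtains r L where "0 < r" "cball y r \<subseteq> U" "L-lipschitz_on (cball y r) f"
proof -
  obtain e L where e: "e > 0" "L-lipschitz_on (cball y e \<inter> U) f"
    using assms(1,3) unfolding locally_lipschitz_on_def by blast
  obtain e' where e': "e' > 0" "cball y e' \<subseteq> U" using assms(2,3) open_contains_cball by blast
  have "cball y (min e e') \<subseteq> cball y e \<inter> U" using e'(2) by auto
  then have "L-lipschitz_on (cball y (min e e')) f" using e(2) lipschitz_on_subset by blast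
  then show thesis using that[of "min e e'" L] e(1) e' \<open>cball y (min e e') \<subseteq> _\<close> by simp
qed

text \<open>The preceding lemma bounds the derivative in the direction \<open>w\<close> at all nearby points of
  differentiability, and the mean value inequality turns this into a bound for increments from \<open>y0\<close>.\<close>

lemma clarke_jacobian_upper_derivative:
  fixes f :: "real ^ 'n \<Rightarrow> real ^ 'm"
  assumes lip: "L-lipschitz_on (cball y0 r) f" and r: "0 < r" "cball y0 r \<subseteq> U"
    and bound: "\<And>M. M \<in> clarke_jacobian U f y0 \<Longrightarrow> u \<bullet> (M *v w) \<le> c" and \<epsilon>: "0 < \<epsilon>"
  shows "\<exists>\<delta>>0. \<forall>s. 0 \<le> s \<and> s < \<delta> \<longrightarrow> u \<bullet> (f (y0 + s *\<^sub>R w) - f y0) \<le> (c + \<epsilon>) * s"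
proof -
  have lipb: "L-lipschitz_on (ball y0 r) f" using lip ball_subset_cball by (rule lipschitz_on_subset)
  have "ball y0 r \<subseteq> U" using r(2) ball_subset_cball by blast
  from clarke_jacobian_upper_semicontinuous[OF lipb r(1) this bound \<epsilon>]
  obtain \<delta> where \<delta>: "\<delta> > 0" "\<And>y. dist y y0 < \<delta> \<Longrightarrow> f differentiable (at y) \<Longrightarrow>
      u \<bullet> (jacobian f (at y) *v w) \<le> c + \<epsilon>" by blast
  \<comment> \<open>The retraction onto the ball extends \<open>f\<close> to a globally Lipschitz function.\<close>
  define F where "F = f \<circ> closest_point (cball y0 r)"
  have ne: "cball y0 r \<noteq> {}" using r by simp
  have F: "L-lipschitz_on UNIV F"
  proof (rule lipschitz_onI)
    fix a b :: "real ^ 'n"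
    have "dist (F a) (F b) \<le> L * dist (closest_point (cball y0 r) a) (closest_point (cball y0 r) b)"
      unfolding F_def comp_def by (intro lipschitz_onD[OF lip] closest_point_in_set closed_cball ne)
    also have "\<dots> \<le> L * dist a b"
      by (intro mult_left_mono closest_point_lipschitz convex_cball closed_cball ne lipschitz_on_nonneg[OF lip])
    finally show "dist (F a) (F b) \<le> L * dist a b" .
  qed (rule lipschitz_on_nonneg[OF lip])
  have Feq: "F y = f y" if "y \<in> cball y0 r" for y
    unfolding F_def comp_def using closest_point_self[OF that] by simp
  define \<delta>' where "\<delta>' = min \<delta> r"
  have \<delta>': "\<delta>' > 0" using \<delta> r by (simp add: \<delta>'_def)
  have mv: "u \<bullet> (F (y0 + s *\<^sub>R w) - F y0) \<le> (c + \<epsilon>) * s" if s: "0 \<le> s" "s * norm w < \<delta>'" for s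
  proof (rule Lipschitz_directional_mean_value[OF F \<delta>' _ s])
    fix y D assume y: "dist y y0 < \<delta>'" and D: "(F has_derivative D) (at y)"
    have fD: "(f has_derivative D) (at y)"
      by (rule has_derivative_transform_within_open[OF D open_ball[of y0 r]])
        (use y Feq in \<open>auto simp: \<delta>'_def dist_commute\<close>)
    then have diff: "f differentiable (at y)" by (auto simp: differentiable_def)
    then have "D = (\<lambda>h. jacobian f (at y) *v h)"
      using has_derivative_unique[OF fD] jacobian_works by blast
    then show "u \<bullet> D w \<le> c + \<epsilon>" using \<delta>(2)[OF _ diff] y by (simp add: \<delta>'_def)
  qed
  show ?thesis
  proof (intro exI[of _ "\<delta>' / (norm w + 1)"] conjI allI impI)
    show "0 < \<delta>' / (norm w + 1)" using \<delta>' by (simp add: add_nonneg_pos)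
    fix s assume s: "0 \<le> s \<and> s < \<delta>' / (norm w + 1)"
    have "norm w + 1 > 0" by (simp add: add_nonneg_pos)
    then have "s * (norm w + 1) < \<delta>'" using s by (simp add: pos_less_divide_eq)
    then have sw: "s * norm w < \<delta>'" using s by (simp add: distrib_left)
    then have "y0 + s *\<^sub>R w \<in> cball y0 r" using s by (simp add: dist_norm \<delta>'_def)
    then show "u \<bullet> (f (y0 + s *\<^sub>R w) - f y0) \<le> (c + \<epsilon>) * s"
      using mv[OF _ sw] s Feq r by simp
  qed
qed

lemma has_vector_derivative_local_increment:
  assumes "(y has_vector_derivative v) (at t)" "0 < e"
  obtains d where "0 < d" "\<And>s. \<bar>s - t\<bar> < d \<Longrightarrow> norm (y s - y t - (s - t) *\<^sub>R v) \<le> e * \<bar>s - t\<bar>"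
  using assms unfolding has_vector_derivative_def has_derivative_at_alt by (auto simp: real_norm_def)

text \<open>The form in which Clarke's chain rule is used: \<open>u \<bullet> M y' \<le> C'\<close> for all elements \<open>M\<close> of the Clarke
  Jacobian, almost everywhere along the path, bounds the increment of \<open>u \<bullet> f\<close> between the end points by
  that of \<open>C\<close>.\<close>

lemma clarke_jacobian_path_increment:
  fixes f :: "real ^ 'n \<Rightarrow> real ^ 'm" and y :: "real \<Rightarrow> real ^ 'n"
  assumes U: "open U" "y ` {0..1} \<subseteq> U" and f: "locally_lipschitz_on U f"
    and y': "\<And>t. (y has_vector_derivative y' t) (at t)"
    and C': "\<And>t. (C has_vector_derivative C' t) (at t)"
    and ae: "AE t in lebesgue_on {0..1}. \<forall>M \<in> clarke_jacobian U f (y t). u \<bullet> (M *v y' t) \<le> C' t"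
  shows "u \<bullet> (f (y 1) - f (y 0)) \<le> C 1 - C 0"
proof -
  define \<phi> where "\<phi> t = u \<bullet> f (y t) - C t" for t
  have "AE t in lebesgue. t \<in> {0..1} \<longrightarrow> (\<forall>M \<in> clarke_jacobian U f (y t). u \<bullet> (M *v y' t) \<le> C' t)"
    using ae by (subst (asm) AE_restrict_space_iff) auto
  then obtain N where N: "negligible N" "\<And>t M. t \<in> {0..1} \<Longrightarrow> t \<notin> N \<Longrightarrow>
      M \<in> clarke_jacobian U f (y t) \<Longrightarrow> u \<bullet> (M *v y' t) \<le> C' t"
    unfolding eventually_ae_filter_negligible by blast
  have incr: "u \<bullet> (f b - f a) \<le> norm u * (L * norm (b - a))" "\<bar>u \<bullet> (f b - f a)\<bar> \<le> norm u * (L * norm (b - a))"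
    if lip: "L-lipschitz_on (cball y0 r) f" and ab: "a \<in> cball y0 r" "b \<in> cball y0 r" for L y0 r a b
  proof -
    have "norm (f b - f a) \<le> L * norm (b - a)"
      using lipschitz_onD[OF lip ab(2,1)] by (simp add: dist_norm)
    then show "\<bar>u \<bullet> (f b - f a)\<bar> \<le> norm u * (L * norm (b - a))"
      by (meson Cauchy_Schwarz_ineq2 mult_left_mono norm_ge_zero order_trans)
    then show "u \<bullet> (f b - f a) \<le> norm u * (L * norm (b - a))" by (simp add: abs_le_iff)
  qed
  have "\<phi> 1 \<le> \<phi> 0"
  proof (rule nonincreasing_if_upper_derivative_nonpos_ae[OF zero_le_one _ N(1)])
    fix t :: real assume t: "t \<in> {0..1}"
    obtain r L where r: "0 < r" "cball (y t) r \<subseteq> U" and lip: "L-lipschitz_on (cball (y t) r) f"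
      using locally_lipschitz_onE[OF f U(1)] U(2) t by blast
    have L: "L \<ge> 0" using lip by (rule lipschitz_on_nonneg)
    obtain d1 where d1: "0 < d1" "\<And>s. \<bar>s - t\<bar> < d1 \<Longrightarrow> norm (y s - y t - (s - t) *\<^sub>R y' t) \<le> 1 * \<bar>s - t\<bar>"
      using has_vector_derivative_local_increment[OF y' zero_less_one] by blast
    obtain d2 where d2: "0 < d2" "\<And>s. \<bar>s - t\<bar> < d2 \<Longrightarrow> norm (C s - C t - (s - t) *\<^sub>R C' t) \<le> 1 * \<bar>s - t\<bar>"
      using has_vector_derivative_local_increment[OF C' zero_less_one] by blast
    define k where "k = norm (y' t) + 1"
    have k: "k > 0" by (simp add: k_def add_nonneg_pos)
    have "\<bar>\<phi> s - \<phi> t\<bar> \<le> (norm u * (L * k) + (\<bar>C' t\<bar> + 1)) * \<bar>s - t\<bar>"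
      if s: "\<bar>s - t\<bar> < min (min d1 d2) (r / k)" for s
    proof -
      have "norm (y s - y t) \<le> norm (y s - y t - (s - t) *\<^sub>R y' t) + norm ((s - t) *\<^sub>R y' t)"
        using norm_triangle_ineq[of "y s - y t - (s - t) *\<^sub>R y' t" "(s - t) *\<^sub>R y' t"] by simp
      then have ys: "norm (y s - y t) \<le> k * \<bar>s - t\<bar>"
        using d1(2)[of s] s by (simp add: k_def distrib_left mult.commute)
      also have "k * \<bar>s - t\<bar> \<le> r" using s k by (simp add: pos_less_divide_eq mult.commute)
      finally have "y s \<in> cball (y t) r" by (simp add: dist_norm norm_minus_commute)
      then have "\<bar>u \<bullet> (f (y s) - f (y t))\<bar> \<le> norm u * (L * norm (y s - y t))"
        using incr(2)[OF lip] r by simp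
      also have "\<dots> \<le> norm u * (L * (k * \<bar>s - t\<bar>))" using ys L by (intro mult_left_mono) auto
      finally have 1: "\<bar>u \<bullet> (f (y s) - f (y t))\<bar> \<le> norm u * (L * k) * \<bar>s - t\<bar>" by (simp add: mult.assoc)
      have "\<bar>C s - C t\<bar> \<le> \<bar>C s - C t - (s - t) * C' t\<bar> + \<bar>(s - t) * C' t\<bar>" by linarith
      also have "\<bar>(s - t) * C' t\<bar> = \<bar>C' t\<bar> * \<bar>s - t\<bar>" by (simp add: abs_mult)
      finally have 2: "\<bar>C s - C t\<bar> \<le> (\<bar>C' t\<bar> + 1) * \<bar>s - t\<bar>"
        using d2(2)[of s] s by (simp add: distrib_right)
      have "\<phi> s - \<phi> t = u \<bullet> (f (y s) - f (y t)) - (C s - C t)" by (simp add: \<phi>_def inner_diff_right)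
      then have "\<bar>\<phi> s - \<phi> t\<bar> \<le> \<bar>u \<bullet> (f (y s) - f (y t))\<bar> + \<bar>C s - C t\<bar>" by linarith
      then show ?thesis using 1 2 by (simp only: distrib_right)
    qed
    then show "\<exists>d>0. \<exists>L. \<forall>s\<in>{0..1}. \<bar>s - t\<bar> < d \<longrightarrow> \<bar>\<phi> s - \<phi> t\<bar> \<le> L * \<bar>s - t\<bar>"
      using d1(1) d2(1) r(1) k by (intro exI[of _ "min (min d1 d2) (r / k)"]) auto
  next
    fix t \<epsilon> :: real assume t: "t \<in> {0..<1}" "t \<notin> N" and \<epsilon>: "0 < \<epsilon>"
    have t01: "t \<in> {0..1}" using t by simp
    obtain r L where r: "0 < r" "cball (y t) r \<subseteq> U" and lip: "L-lipschitz_on (cball (y t) r) f"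
      using locally_lipschitz_onE[OF f U(1)] U(2) t01 by blast
    have L: "L \<ge> 0" using lip by (rule lipschitz_on_nonneg)
    define w where "w = y' t"
    define e where "e = \<epsilon> / 4"
    have e: "e > 0" using \<epsilon> by (simp add: e_def)
    define e1 where "e1 = min 1 (e / (norm u * L + 1))"
    have den: "norm u * L + 1 > 0" using L by (simp add: add_nonneg_pos)
    have e1: "e1 > 0" using e den by (simp add: e1_def)
    have "(norm u * L) * e1 \<le> (norm u * L + 1) * (e / (norm u * L + 1))"
      using L e1 by (intro mult_mono) (auto simp: e1_def)
    then have e1': "(norm u * L) * e1 \<le> e" using den by simp
    obtain d0 where d0: "d0 > 0" "\<And>s. 0 \<le> s \<Longrightarrow> s < d0 \<Longrightarrow> u \<bullet> (f (y t + s *\<^sub>R w) - f (y t)) \<le> (C' t + e) * s"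
      using clarke_jacobian_upper_derivative[OF lip r N(2)[OF t01 t(2)] e] unfolding w_def by blast
    obtain d1 where d1: "0 < d1" "\<And>s. \<bar>s - t\<bar> < d1 \<Longrightarrow> norm (y s - y t - (s - t) *\<^sub>R w) \<le> e1 * \<bar>s - t\<bar>"
      using has_vector_derivative_local_increment[OF y' e1] unfolding w_def by blast
    obtain d2 where d2: "0 < d2" "\<And>s. \<bar>s - t\<bar> < d2 \<Longrightarrow> norm (C s - C t - (s - t) *\<^sub>R C' t) \<le> e * \<bar>s - t\<bar>"
      using has_vector_derivative_local_increment[OF C' e] by blast
    define k where "k = norm w + 1"
    have k: "k > 0" by (simp add: k_def add_nonneg_pos)
    have "\<phi> (t + h) - \<phi> t \<le> \<epsilon> * h" if h: "0 < h" "h < min (min d0 d1) (min d2 (r / k))" for h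
    proof -
      have hk: "h * k < r" using h k by (simp add: pos_less_divide_eq)
      have y1: "norm (y (t + h) - (y t + h *\<^sub>R w)) \<le> e1 * h"
        using d1(2)[of "t + h"] h by (simp add: algebra_simps)
      also have "e1 * h \<le> h" using h by (simp add: e1_def)
      finally have "norm (y (t + h) - (y t + h *\<^sub>R w)) \<le> h" .
      then have "norm (y (t + h) - y t) \<le> h + h * norm w"
        using norm_triangle_ineq[of "y (t + h) - (y t + h *\<^sub>R w)" "h *\<^sub>R w"] h by simp
      then have in1: "y (t + h) \<in> cball (y t) r"
        using hk by (simp add: k_def dist_norm norm_minus_commute algebra_simps)
      have "h * norm w \<le> r" using hk h by (simp add: k_def algebra_simps)
      then have in2: "y t + h *\<^sub>R w \<in> cball (y t) r" using h by (simp add: dist_norm)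
      have "u \<bullet> (f (y (t + h)) - f (y t + h *\<^sub>R w)) \<le> norm u * (L * norm (y (t + h) - (y t + h *\<^sub>R w)))"
        by (rule incr(1)[OF lip in2 in1])
      also have "\<dots> \<le> norm u * (L * (e1 * h))" using y1 L by (intro mult_left_mono) auto
      also have "\<dots> = (norm u * L * e1) * h" by simp
      also have "\<dots> \<le> e * h" using e1' h by (intro mult_right_mono) auto
      finally have 1: "u \<bullet> (f (y (t + h)) - f (y t + h *\<^sub>R w)) \<le> e * h" .
      have 2: "u \<bullet> (f (y t + h *\<^sub>R w) - f (y t)) \<le> C' t * h + e * h"
        using d0(2)[of h] h by (simp add: distrib_right)
      have "\<bar>C (t + h) - C t - h * C' t\<bar> \<le> e * h" using d2(2)[of "t + h"] h by simp
      then have 3: "C t - C (t + h) \<le> e * h - C' t * h" by (simp add: abs_le_iff mult.commute)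
      have "\<phi> (t + h) - \<phi> t = u \<bullet> (f (y (t + h)) - f (y t + h *\<^sub>R w))
          + u \<bullet> (f (y t + h *\<^sub>R w) - f (y t)) + (C t - C (t + h))"
        by (simp add: \<phi>_def inner_diff_right)
      also have "\<dots> \<le> 3 * (e * h)" using 1 2 3 by linarith
      also have "\<dots> \<le> \<epsilon> * h" using h \<epsilon> by (simp add: e_def)
      finally show ?thesis .
    qed
    then show "\<exists>\<delta>>0. \<forall>h. 0 < h \<and> h < \<delta> \<longrightarrow> \<phi> (t + h) - \<phi> t \<le> \<epsilon> * h"
      using d0(1) d1(1) d2(1) r(1) k by (intro exI[of _ "min (min d0 d1) (min d2 (r / k))"]) auto
  qed
  then show ?thesis by (simp add: \<phi>_def inner_diff_right)
qed

section \<open>Geodesics on the sphere and the descent estimate\<close>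

lemma perp_part_eq: "perp_part x z = z - (x \<bullet> z) *\<^sub>R x"
proof -
  have "((\<chi> i j. x $ i * x $ j) *v z) = (x \<bullet> z) *\<^sub>R x"
    by (simp add: vec_eq_iff matrix_vector_mult_def inner_vec_def sum_distrib_left mult_ac)
  then show ?thesis by (simp add: perp_part_def matrix_vector_mult_diff_rdistrib)
qed

text \<open>The point \<open>xs\<close> lies at angle \<open>\<theta>\<close> from \<open>x\<close> on the great circle through \<open>x\<close> with unit tangent \<open>v\<close>.\<close>

lemma geodesic_frame:
  fixes x xs :: "real ^ 'n"
  defines "\<theta> \<equiv> sphere_angle x xs" and "v \<equiv> geodesic_dir x xs"
  assumes x: "norm x = 1" and xs: "norm xs = 1" and \<theta>: "0 < \<theta>" "\<theta> < pi"
  shows "norm v = 1" "x \<bullet> v = 0" "xs = cos \<theta> *\<^sub>R x + sin \<theta> *\<^sub>R v"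
proof -
  have ip: "\<bar>x \<bullet> xs\<bar> \<le> 1" using Cauchy_Schwarz_ineq2[of x xs] x xs by simp
  then have cos: "cos \<theta> = x \<bullet> xs" by (simp add: \<theta>_def sphere_angle_def abs_le_iff)
  have sin: "sin \<theta> > 0" using \<theta> by (rule sin_gt_zero)
  define p where "p = perp_part x xs"
  have p: "p = xs - cos \<theta> *\<^sub>R x" by (simp add: p_def perp_part_eq cos)
  have xx: "x \<bullet> x = 1" "xs \<bullet> xs = 1" using x xs by (simp_all add: norm_eq_1)
  have "(norm p)\<^sup>2 = 1 - (cos \<theta>)\<^sup>2"
    unfolding power2_norm_eq_inner
    by (simp add: p inner_diff_left inner_diff_right xx cos inner_commute power2_eq_square)
  then have "(norm p)\<^sup>2 = (sin \<theta>)\<^sup>2" by (simp add: sin_squared_eq)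
  then have np: "norm p = sin \<theta>" using sin by (simp add: power2_eq_iff_nonneg)
  have v: "v = p /\<^sub>R sin \<theta>" by (simp add: v_def geodesic_dir_def np flip: p_def)
  show "norm v = 1" using sin by (simp add: v np)
  show "x \<bullet> v = 0" by (simp add: v p inner_diff_right xx cos)
  show "xs = cos \<theta> *\<^sub>R x + sin \<theta> *\<^sub>R v" using sin by (simp add: v p)
qed

lemma geodesic_has_vector_derivative:
  "(geodesic x xs has_vector_derivative sphere_angle x xs *\<^sub>R
     (cos (t * sphere_angle x xs) *\<^sub>R geodesic_dir x xs - sin (t * sphere_angle x xs) *\<^sub>R x)) (at t)"
  unfolding geodesic_def[abs_def]
  by (auto intro!: derivative_eq_intros simp: algebra_simps)

lemma le_tan:
  fixes x :: real
  assumes x: "0 \<le> x" "x < pi / 2"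
  shows "x \<le> tan x"
proof -
  have "sin 0 - 0 * cos 0 \<le> sin x - x * cos x"
  proof (rule DERIV_nonneg_imp_nondecreasing[where f = "\<lambda>z. sin z - z * cos z"])
    fix z :: real assume z: "0 \<le> z" "z \<le> x"
    have "((\<lambda>z. sin z - z * cos z) has_real_derivative z * sin z) (at z)"
      by (auto intro!: derivative_eq_intros)
    moreover have "0 \<le> z * sin z" using z x by (intro mult_nonneg_nonneg sin_ge_zero) auto
    ultimately show "\<exists>d. ((\<lambda>z. sin z - z * cos z) has_real_derivative d) (at z) \<and> 0 \<le> d" by blast
  qed (use x in simp)
  moreover have "cos x > 0" using x by (intro cos_gt_zero_pi) auto
  ultimately show ?thesis by (simp add: tan_def pos_le_divide_eq)
qed

(* The bound sphere_angle x xs < pi expresses that tan (theta / 2) is defined;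
   in HOL, tan (pi / 2) = 0, so the antipodal point has to be excluded explicitly. *)

theorem theorem4p18:
  fixes g :: "real ^ 'd \<Rightarrow> real ^ 'd \<Rightarrow> real ^ 'd"
    and B \<mu> \<theta>bar :: real
    and xs x :: "real ^ 'd"
  assumes tangent: "\<And>x y. x \<in> sphere 0 1 \<Longrightarrow> y \<in> sphere 0 1 \<Longrightarrow> g x y \<in> tangent_space x"
    and "B > 0" and "\<mu> > 0"
    and "xs \<in> sphere 0 1"
    and "0 < \<theta>bar" and "\<theta>bar < pi / 2"
    and stationarity: "\<And>x. x \<in> sphere 0 1 \<Longrightarrow> g x x = 0"
    and bounded_curvature: "\<And>x. x \<in> sphere 0 1 \<Longrightarrow> sphere_angle x xs \<in> {0<..\<theta>bar} \<Longrightarrow>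
          bounded_curvature_at g B \<mu> xs x"
    and "x \<in> sphere 0 1"
    and "sphere_angle x xs > 0" and "sphere_angle x xs < pi"
    and "tan (sphere_angle x xs / 2) \<le> min (\<mu> / (2 * B)) (tan (\<theta>bar / 2))"
  shows "g x xs \<bullet> xs \<le> - (\<mu> / (4 * B)) * norm (g x xs) * sin (sphere_angle x xs) \<and>
         rga (\<mu> / (4 * B)) x xs (g x xs)"
proof -
  define \<theta> where "\<theta> = sphere_angle x xs"
  define v where "v = geodesic_dir x xs"
  define G where "G = g x xs"
  have nx: "norm x = 1" and nxs: "norm xs = 1" using assms by simp_all
  have \<theta>: "0 < \<theta>" "\<theta> < pi" using assms by (simp_all add: \<theta>_def)
  have v: "norm v = 1" "x \<bullet> v = 0" "xs = cos \<theta> *\<^sub>R x + sin \<theta> *\<^sub>R v"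
    using geodesic_frame[OF nx nxs] \<theta> by (simp_all add: \<theta>_def v_def)
  have tan_le: "tan (\<theta> / 2) \<le> \<mu> / (2 * B)" "tan (\<theta> / 2) \<le> tan (\<theta>bar / 2)"
    using assms by (simp_all add: \<theta>_def)
  have \<theta>_le: "\<theta> \<le> \<theta>bar"
  proof (rule ccontr)
    assume "\<not> ?thesis"
    then have "tan (\<theta>bar / 2) < tan (\<theta> / 2)"
      using \<theta> \<open>0 < \<theta>bar\<close> by (intro tan_monotone) auto
    then show False using tan_le by simp
  qed
  have sin: "sin \<theta> > 0" using \<theta> by (rule sin_gt_zero)
  have cos: "cos \<theta> > 0" using \<theta> \<theta>_le \<open>\<theta>bar < pi / 2\<close> by (intro cos_gt_zero) auto
  have half: "tan (\<theta> / 2) = sin \<theta> / (cos \<theta> + 1)"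
    using tan_half[of "\<theta> / 2"] by simp
  have "bounded_curvature_at g B \<mu> xs x"
    by (rule bounded_curvature) (use assms \<theta> \<theta>_le in \<open>auto simp: \<theta>_def\<close>)
  then obtain U gt where U: "open U" "geodesic x xs ` {0..1} \<subseteq> U"
    and gt: "\<forall>y \<in> U \<inter> sphere 0 1. gt y = g x y"
    and lip: "locally_lipschitz_on U gt"
    and ae: "AE t in lebesgue_on {0..1}. \<forall>M \<in> clarke_jacobian U gt (geodesic x xs t).
           v \<bullet> (M *v v) \<le> - \<mu> \<and> onorm ((*v) M) \<le> B"
    unfolding bounded_curvature_at_def v_def by blast
  have geo0: "geodesic x xs 0 = x" and geo1: "geodesic x xs 1 = xs"
    using v(3) by (simp_all add: geodesic_def \<theta>_def v_def)
  have "x \<in> U" "xs \<in> U" using U(2) geo0 geo1 by (metis atLeastAtMost_iff image_subset_iff order_refl zero_le_one)+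
  then have diffG: "gt (geodesic x xs 1) - gt (geodesic x xs 0) = G"
    using gt nx nxs stationarity[of x] by (simp add: geo0 geo1 G_def)
  define y' where "y' t = \<theta> *\<^sub>R (cos (t * \<theta>) *\<^sub>R v - sin (t * \<theta>) *\<^sub>R x)" for t
  have y': "(geodesic x xs has_vector_derivative y' t) (at t)" for t
    unfolding y'_def \<theta>_def v_def by (rule geodesic_has_vector_derivative)
  have "(norm (y' t))\<^sup>2 = \<theta>\<^sup>2" for t
  proof -
    have "(norm (cos (t * \<theta>) *\<^sub>R v - sin (t * \<theta>) *\<^sub>R x))\<^sup>2 = (cos (t * \<theta>))\<^sup>2 + (sin (t * \<theta>))\<^sup>2"
      unfolding power2_norm_eq_inner using v(1,2) nx
      by (simp add: inner_diff_left inner_diff_right inner_commute norm_eq_1 power2_eq_square)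
    then show ?thesis by (simp add: y'_def power_mult_distrib)
  qed
  then have ny': "norm (y' t) = \<theta>" for t using \<theta> by (simp add: power2_eq_iff_nonneg)
  have onorm_le: "norm (M *v h) \<le> B * norm h" if "onorm ((*v) M) \<le> B" for M :: "real ^ 'd ^ 'd" and h
    using onorm[of "(*v) M" h] that mult_right_mono[OF that norm_ge_zero[of h]]
    by (simp add: matrix_vector_mul_bounded_linear)
  have t\<theta>: "0 \<le> t * \<theta>" "t * \<theta> \<le> \<theta>" if "t \<in> {0..1}" for t
    using that \<theta> by (auto intro: mult_left_le_one_le)
  have sin_nonneg: "0 \<le> sin (t * \<theta>)" if "t \<in> {0..1}" for t
    using t\<theta>[OF that] \<theta> by (intro sin_ge_zero) linarith+

  \<comment> \<open>The bound \<open>\<theta> (B sin (t \<theta>) - \<mu> cos (t \<theta>))\<close> for \<open>v \<bullet> M y'\<close> integrates to \<open>B (1 - cos \<theta>) - \<mu> sin \<theta>\<close>.\<close>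
  have descent: "v \<bullet> G \<le> - (\<mu> / 2) * sin \<theta>"
  proof -
    define C where "C t = - B * cos (t * \<theta>) - \<mu> * sin (t * \<theta>)" for t
    have C': "(C has_vector_derivative \<theta> * (B * sin (t * \<theta>) - \<mu> * cos (t * \<theta>))) (at t)" for t
      unfolding C_def[abs_def] has_real_derivative_iff_has_vector_derivative[symmetric]
      by (auto intro!: derivative_eq_intros simp: algebra_simps)
    have "v \<bullet> (gt (geodesic x xs 1) - gt (geodesic x xs 0)) \<le> C 1 - C 0"
    proof (rule clarke_jacobian_path_increment[OF U lip y' C'])
      show "AE t in lebesgue_on {0..1}. \<forall>M\<in>clarke_jacobian U gt (geodesic x xs t).
          v \<bullet> (M *v y' t) \<le> \<theta> * (B * sin (t * \<theta>) - \<mu> * cos (t * \<theta>))"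
        using ae AE_space
      proof eventually_elim
        case (elim t)
        show ?case
        proof
          fix M assume "M \<in> clarke_jacobian U gt (geodesic x xs t)"
          then have M: "v \<bullet> (M *v v) \<le> - \<mu>" "onorm ((*v) M) \<le> B" using elim by auto
          have t: "t \<in> {0..1}" using elim by simp
          have tc: "0 \<le> cos (t * \<theta>)"
            using t\<theta>[OF t] \<theta>_le \<open>\<theta>bar < pi / 2\<close>
            by (intro cos_ge_zero) linarith+
          have "\<bar>v \<bullet> (M *v x)\<bar> \<le> B"
            using Cauchy_Schwarz_ineq2[of v "M *v x"] onorm_le[OF M(2), of x] v(1) nx by simp
          then have "- (v \<bullet> (M *v x)) \<le> B" by simp
          then have "sin (t * \<theta>) * - (v \<bullet> (M *v x)) \<le> sin (t * \<theta>) * B"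
            using sin_nonneg[OF t] by (rule mult_left_mono)
          moreover have "cos (t * \<theta>) * (v \<bullet> (M *v v)) \<le> cos (t * \<theta>) * - \<mu>"
            using M(1) tc by (rule mult_left_mono)
          ultimately have "cos (t * \<theta>) * (v \<bullet> (M *v v)) - sin (t * \<theta>) * (v \<bullet> (M *v x))
              \<le> B * sin (t * \<theta>) - \<mu> * cos (t * \<theta>)" by (simp add: mult.commute)
          then have "\<theta> * (cos (t * \<theta>) * (v \<bullet> (M *v v)) - sin (t * \<theta>) * (v \<bullet> (M *v x)))
              \<le> \<theta> * (B * sin (t * \<theta>) - \<mu> * cos (t * \<theta>))"
            using \<theta> by (intro mult_left_mono) auto
          moreover have "v \<bullet> (M *v y' t) = \<theta> * (cos (t * \<theta>) * (v \<bullet> (M *v v)) - sin (t * \<theta>) * (v \<bullet> (M *v x)))"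
            by (simp add: y'_def matrix_vector_mult_scaleR matrix_vector_mult_diff_distrib inner_diff_right)
          ultimately show "v \<bullet> (M *v y' t) \<le> \<theta> * (B * sin (t * \<theta>) - \<mu> * cos (t * \<theta>))" by simp
        qed
      qed
    qed
    then have "v \<bullet> G \<le> B * (1 - cos \<theta>) - \<mu> * sin \<theta>"
      by (simp add: diffG C_def algebra_simps)
    also have "1 - cos \<theta> = tan (\<theta> / 2) * sin \<theta>"
    proof -
      have "(1 - cos \<theta>) * (cos \<theta> + 1) = sin \<theta> * sin \<theta>"
        using sin_squared_eq[of \<theta>] by (simp add: power2_eq_square algebra_simps)
      then show ?thesis using cos by (simp add: half eq_divide_eq)
    qed
    also have "B * (tan (\<theta> / 2) * sin \<theta>) \<le> B * (\<mu> / (2 * B) * sin \<theta>)"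
      using tan_le(1) sin \<open>B > 0\<close> by (intro mult_left_mono mult_right_mono) auto
    also have "B * (\<mu> / (2 * B) * sin \<theta>) = \<mu> / 2 * sin \<theta>" using \<open>B > 0\<close> by simp
    finally show ?thesis by simp
  qed

  have "norm G \<le> B * \<theta>"
  proof (cases "G = 0")
    case True
    then show ?thesis using \<theta> \<open>B > 0\<close> by simp
  next
    case False
    \<comment> \<open>The norm of \<open>G\<close> is the increment of the component in the direction of \<open>G\<close>.\<close>
    define u where "u = G /\<^sub>R norm G"
    have u: "norm u = 1" using False by (simp add: u_def)
    have C': "((\<lambda>t. B * \<theta> * t) has_vector_derivative B * \<theta>) (at t)" for t :: real
      unfolding has_real_derivative_iff_has_vector_derivative[symmetric]
      by (auto intro!: derivative_eq_intros)
    have "u \<bullet> (gt (geodesic x xs 1) - gt (geodesic x xs 0)) \<le> B * \<theta> * 1 - B * \<theta> * 0"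
    proof (rule clarke_jacobian_path_increment[OF U lip y' C'])
      show "AE t in lebesgue_on {0..1}. \<forall>M\<in>clarke_jacobian U gt (geodesic x xs t).
          u \<bullet> (M *v y' t) \<le> B * \<theta>"
        using ae
      proof eventually_elim
        case (elim t)
        show ?case
        proof
          fix M assume "M \<in> clarke_jacobian U gt (geodesic x xs t)"
          then have M: "onorm ((*v) M) \<le> B" using elim by auto
          have "u \<bullet> (M *v y' t) \<le> norm u * norm (M *v y' t)" by (rule norm_cauchy_schwarz)
          also have "\<dots> \<le> B * \<theta>" using onorm_le[OF M, of "y' t"] u by (simp add: ny')
          finally show "u \<bullet> (M *v y' t) \<le> B * \<theta>" .
        qed
      qed
    qed
    moreover have "u \<bullet> G = norm G"
      using False by (simp add: u_def dot_square_norm power2_eq_square)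
    ultimately show ?thesis by (simp add: diffG)
  qed
  moreover have "\<theta> \<le> 2 * sin \<theta>"
  proof -
    have "\<theta> / 2 \<le> tan (\<theta> / 2)" using \<theta> by (intro le_tan) auto
    also have "\<dots> \<le> sin \<theta>" using sin cos by (simp add: half pos_divide_le_eq)
    finally show ?thesis by simp
  qed
  then have "B * \<theta> \<le> 2 * B * sin \<theta>" using \<open>B > 0\<close> by simp
  ultimately have norm_le: "norm G \<le> 2 * B * sin \<theta>" by linarith

  have tanG: "x \<bullet> G = 0"
    using tangent[of x xs] assms by (simp add: G_def tangent_space_def)
  have "G \<bullet> xs = sin \<theta> * (v \<bullet> G)"
    by (subst v(3)) (simp add: inner_add_right tanG inner_commute[of G])
  also have "\<dots> \<le> sin \<theta> * (- (\<mu> / 2) * sin \<theta>)"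
    using descent sin by (intro mult_left_mono) auto
  also have "\<dots> = - (\<mu> / (4 * B)) * (2 * B * sin \<theta>) * sin \<theta>" using \<open>B > 0\<close> by simp
  also have "\<dots> \<le> - (\<mu> / (4 * B)) * norm G * sin \<theta>"
  proof -
    have "\<mu> / (4 * B) * norm G * sin \<theta> \<le> \<mu> / (4 * B) * (2 * B * sin \<theta>) * sin \<theta>"
      using norm_le sin \<open>B > 0\<close> \<open>\<mu> > 0\<close> by (intro mult_right_mono mult_left_mono) auto
    then show ?thesis by simp
  qed
  finally have main: "G \<bullet> xs \<le> - (\<mu> / (4 * B)) * norm G * sin \<theta>" .
  have "\<mu> / 2 * sin \<theta> > 0" using \<open>\<mu> > 0\<close> sin by simp
  then have "v \<bullet> G < 0" using descent by simp
  then have "G \<noteq> 0" by auto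
  then show ?thesis
    using main tanG by (simp add: rga_def tangent_space_def mult_ac flip: G_def \<theta>_def)
qed

end
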